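(* Let the penalty function $P:\mathbb R\to\mathbb R$ be monotone and convex, such that $P(s)=0$ for all $s\le0$ and $P(s)>0$ for all $s>0$. Apply the Penalty Algorithm described in the context. If $\gamma_{k,\bar T_k}\to\infty$, then the algorithm either stops at a global solution of (OVR), or the computed sequence $(\beta_k,y_k,u_k)$ contains a subsequence converging strongly in $\mathbb R^n\times Y\times U$ to a global solution of (OVR). If (OVR) has a unique global solution $(\bar\beta,\bar y,\bar u)$, then the entire sequence $(\beta_k,y_k,u_k)$ converges strongly to $(\bar\beta,\bar y,\bar u)$.
   Context: **Standing setting.** $Y,U$ are real Hilbert spaces with duals $Y^*,U^*$. $Q\subset\mathbb R^n$ is a nonempty bounded polyhedron (intersection of finitely many closed halfspaces) with nonempty interior. $U_{ad}\subset U$ is nonempty, closed, convex. $A\in L[Y,Y^*]$ is an isomorphism, $B\in L[U,Y^*]$ is bounded linear, $S:=A^{-1}B\in L[U,Y]$. The functionals $F,f:Q\times Y\times U\to\mathbb R$ are bounded from below, convex and continuously Fréchet differentiable. For every $M\ge 0$ there is $L_M\ge 0$ such that $\|f'_\beta(\beta_1,y_1,u_1)-f'_\beta(\beta_2,y_2,u_2)\|\le L_M(\|\beta_1-\beta_2\|+\|y_1-y_2\|_Y+\|u_1-u_2\|_U)$, $|F(\beta,y_1,u_1)-F(\beta,y_2,u_2)|\le L_M(\|y_1-y_2\|_Y+\|u_1-u_2\|_U)$, $\|f'_u(\beta_1,S(u),u)-f'_u(\beta_2,S(u),u)\|_{U^*}\le L_M\|\beta_1-\beta_2\|$, $\|f'_y(\beta_1,S(u),u)-f'_y(\beta_2,S(u),u)\|_{Y^*}\le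 L_M\|\beta_1-\beta_2\|$ for all $\beta,\beta_1,\beta_2\in Q$, all $y_1,y_2\in Y$ of norm $\le M$ and all $u,u_1,u_2\in U_{ad}$ of norm $\le M$. There is $\mu>0$ such that for all $\beta\in Q$, $u_1,u_2\in U_{ad}$: $f(\beta,S(u_2),u_2)\ge f(\beta,S(u_1),u_1)+\langle f'_y(\cdot),S(u_2-u_1)\rangle+\langle f'_u(\cdot),u_2-u_1\rangle+\frac\mu2\|u_2-u_1\|_U^2$, with derivatives taken at $(\beta,S(u_1),u_1)$. **Problem.** $\varphi(\beta):=\inf\{f(\beta,y,u): (y,u)\in Y\times U_{ad},\ Ay=Bu\}$ for $\beta\in Q$. Problem (OVR): minimize $F(\beta,y,u)$ subject to $\beta\in Q$, $f(\beta,y,u)\le\varphi(\beta)$, $Ay-Bu=0$, $u\in U_{ad}$. **Subdivisions.** A subdivision $\mathcal T$ of $Q$ is a finite set of non-degenerate $n$-simplices whose union is $Q$. For a simplex $T$, $\xi_T:T\to\mathbb R$ is the affine function interpolating $\varphi$ at the vertices of $T$, and $\rho(T):=\operatorname{diam}(B_T)/\operatorname{diam}(T)$, where $B_T$ is the largest ball contained in $T$. **Penalty Algorithm.** (S1) Let $\mathcal T_1$ be a subdivision of $Q$, select $q,\rho\in(0,1)$ (with $\rho\le\min_{T\in\mathcal T_1}\rho(T)$) and a non-decreasing function $P:\mathbb R\to\mathbb R$ with $P(0)=0$; set $k:=1$. (S2) For every $T\in\mathcal T_k$ choose $\gamma_{k,T}>0$ and compute a global solution $(\beta_{k,T},y_{k,T},u_{k,T})$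 of: minimize $F(\beta,y,u)+\gamma_{k,T}P(f(\beta,y,u)-\xi_T(\beta))$ subject to $\beta\in T$, $Ay-Bu=0$, $u\in U_{ad}$. Select $\bar T_k\in\mathcal T_k$ minimizing $F(\beta_{k,T},y_{k,T},u_{k,T})+\gamma_{k,T}P(f(\beta_{k,T},y_{k,T},u_{k,T})-\xi_T(\beta_{k,T}))$ over $T\in\mathcal T_k$ and set $(\beta_k,y_k,u_k):=(\beta_{k,\bar T_k},y_{k,\bar T_k},u_{k,\bar T_k})$. (S3) If $f(\beta_k,y_k,u_k)=\varphi(\beta_k)$, stop. Otherwise construct the subdivision $\mathcal T_{k+1}$ from $\mathcal T_k$ by a refinement of $\bar T_k$ (replacing $\bar T_k$ by finitely many simplices whose union is $\bar T_k$) such that $\operatorname{vol}(T)\le q\operatorname{vol}(\bar T_k)$ and $\rho(T)\ge\rho$ for all $T\in\mathcal T_{k+1}\setminus\mathcal T_k$. Set $k:=k+1$ and go to (S2). *)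

theory Defs
  imports "HOL-Analysis.Analysis"
begin

section \<open>Derivatives and the state equation\<close>

text \<open>
  Triples \<open>(\<beta>, y, u)\<close> range over the product normed space \<open>(real ^ 'n) \<times> 'y \<times> 'u\<close>.
  The sets \<open>X\<close> below are of the form \<open>Q \<times> UNIV \<times> UNIV\<close> with \<open>Q\<close> convex with nonempty
  interior, so the derivative within \<open>X\<close> is unique at every point of \<open>X\<close>, including
  boundary points.
\<close>

definition has_C1_derivative_on ::
  "('a::real_normed_vector \<Rightarrow> real) \<Rightarrow> ('a \<Rightarrow> 'a \<Rightarrow>\<^sub>L real) \<Rightarrow> 'a set \<Rightarrow> bool"
  where "has_C1_derivative_on g g' X \<longleftrightarrow>
    (\<forall>x\<in>X. (g has_derivative blinfun_apply (g' x)) (at x within X)) \<and> continuous_on X g'"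

text \<open>The partial Frechet derivatives, obtained from the total derivative \<open>D\<close> at a point.\<close>

definition partial_beta ::
  "(('b::real_normed_vector \<times> 'y::real_normed_vector \<times> 'u::real_normed_vector) \<Rightarrow>\<^sub>L real) \<Rightarrow> ('b \<Rightarrow>\<^sub>L real)"
  where "partial_beta D = Blinfun (\<lambda>h. blinfun_apply D (h, 0, 0))"

definition partial_y ::
  "(('b::real_normed_vector \<times> 'y::real_normed_vector \<times> 'u::real_normed_vector) \<Rightarrow>\<^sub>L real) \<Rightarrow> ('y \<Rightarrow>\<^sub>L real)"
  where "partial_y D = Blinfun (\<lambda>h. blinfun_apply D (0, h, 0))"

definition partial_u ::
  "(('b::real_normed_vector \<times> 'y::real_normed_vector \<times> 'u::real_normed_vector) \<Rightarrow>\<^sub>L real) \<Rightarrow> ('u \<Rightarrow>\<^sub>L real)"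
  where "partial_u D = Blinfun (\<lambda>h. blinfun_apply D (0, 0, h))"

lemma partial_beta_apply [simp]: "blinfun_apply (partial_beta D) h = blinfun_apply D (h, 0, 0)"
  unfolding partial_beta_def
  by (subst bounded_linear_Blinfun_apply)
    (auto intro!: bounded_linear_intros)

lemma partial_y_apply [simp]: "blinfun_apply (partial_y D) h = blinfun_apply D (0, h, 0)"
  unfolding partial_y_def
  by (subst bounded_linear_Blinfun_apply)
    (auto intro!: bounded_linear_intros)

lemma partial_u_apply [simp]: "blinfun_apply (partial_u D) h = blinfun_apply D (0, 0, h)"
  unfolding partial_u_def
  by (subst bounded_linear_Blinfun_apply)
    (auto intro!: bounded_linear_intros)

definition isomorphism_blinfun :: "('a::real_normed_vector \<Rightarrow>\<^sub>L 'b::real_normed_vector) \<Rightarrow> bool"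
  where "isomorphism_blinfun A \<longleftrightarrow>
    (\<exists>A' :: 'b \<Rightarrow>\<^sub>L 'a. A' o\<^sub>L A = id_blinfun \<and> A o\<^sub>L A' = id_blinfun)"

text \<open>The operator \<open>S = A\<^sup>-\<^sup>1 B\<close>; used only for isomorphisms \<open>A\<close>.\<close>

definition sol_op ::
  "('y::real_normed_vector \<Rightarrow>\<^sub>L 'z::real_normed_vector) \<Rightarrow> ('u::real_normed_vector \<Rightarrow>\<^sub>L 'z) \<Rightarrow> 'u \<Rightarrow> 'y"
  where "sol_op A B u = inv (blinfun_apply A) (blinfun_apply B u)"


section \<open>The optimal-value function and the problem (OVR)\<close>

definition phi ::
  "('b \<times> 'y::real_normed_vector \<times> 'u::real_normed_vector \<Rightarrow> real) \<Rightarrow> 'u set \<Rightarrow>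
   ('y \<Rightarrow>\<^sub>L 'z::real_normed_vector) \<Rightarrow> ('u \<Rightarrow>\<^sub>L 'z) \<Rightarrow> 'b \<Rightarrow> real"
  where "phi f Uad A B \<beta> =
    Inf {f (\<beta>, y, u) | y u. u \<in> Uad \<and> blinfun_apply A y = blinfun_apply B u}"

definition ovr_feasible ::
  "'b set \<Rightarrow> ('b \<times> 'y::real_normed_vector \<times> 'u::real_normed_vector \<Rightarrow> real) \<Rightarrow> 'u set \<Rightarrow>
   ('y \<Rightarrow>\<^sub>L 'z::real_normed_vector) \<Rightarrow> ('u \<Rightarrow>\<^sub>L 'z) \<Rightarrow> 'b \<times> 'y \<times> 'u \<Rightarrow> bool"
  where "ovr_feasible Q f Uad A B = (\<lambda>(\<beta>, y, u).
    \<beta> \<in> Q \<and> f (\<beta>, y, u) \<le> phi f Uad A B \<beta> \<and>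
    blinfun_apply A y - blinfun_apply B u = 0 \<and> u \<in> Uad)"

definition ovr_global_solution ::
  "'b set \<Rightarrow> ('b \<times> 'y::real_normed_vector \<times> 'u::real_normed_vector \<Rightarrow> real) \<Rightarrow>
   ('b \<times> 'y \<times> 'u \<Rightarrow> real) \<Rightarrow> 'u set \<Rightarrow>
   ('y \<Rightarrow>\<^sub>L 'z::real_normed_vector) \<Rightarrow> ('u \<Rightarrow>\<^sub>L 'z) \<Rightarrow> 'b \<times> 'y \<times> 'u \<Rightarrow> bool"
  where "ovr_global_solution Q F f Uad A B = is_arg_min F (ovr_feasible Q f Uad A B)"


section \<open>Subdivisions\<close>

definition subdivision :: "(real ^ 'n) set \<Rightarrow> (real ^ 'n) set set \<Rightarrow> bool"
  where "subdivision Q \<T> \<longleftrightarrow>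
    finite \<T> \<and> (\<forall>T\<in>\<T>. int CARD('n) simplex T) \<and> \<Union>\<T> = Q"

text \<open>
  The affine function interpolating \<open>g\<close> at the vertices of the nondegenerate simplex \<open>T\<close>,
  extended (uniquely) from \<open>T\<close> to an affine function on the whole space.
\<close>

definition affine_interp :: "((real ^ 'n) \<Rightarrow> real) \<Rightarrow> (real ^ 'n) set \<Rightarrow> (real ^ 'n) \<Rightarrow> real"
  where "affine_interp g T = (THE \<xi>.
    (\<exists>a c. \<xi> = (\<lambda>x. a \<bullet> x + c)) \<and> (\<forall>v. v extreme_point_of T \<longrightarrow> \<xi> v = g v))"

definition is_largest_ball :: "(real ^ 'n) set \<Rightarrow> (real ^ 'n) set \<Rightarrow> bool"
  where "is_largest_ball S T \<longleftrightarrow>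
    (\<exists>c r. 0 \<le> r \<and> S = cball c r \<and> cball c r \<subseteq> T \<and> (\<forall>c' r'. cball c' r' \<subseteq> T \<longrightarrow> r' \<le> r))"

definition shape_ratio :: "(real ^ 'n) set \<Rightarrow> real"
  where "shape_ratio T = diameter (SOME S. is_largest_ball S T) / diameter T"


section \<open>The penalty algorithm\<close>

definition penalty_objective ::
  "((real ^ 'n) \<times> 'y::real_normed_vector \<times> 'u::real_normed_vector \<Rightarrow> real) \<Rightarrow>
   ((real ^ 'n) \<times> 'y \<times> 'u \<Rightarrow> real) \<Rightarrow> 'u set \<Rightarrow>
   ('y \<Rightarrow>\<^sub>L 'z::real_normed_vector) \<Rightarrow> ('u \<Rightarrow>\<^sub>L 'z) \<Rightarrow> (real \<Rightarrow> real) \<Rightarrow>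
   real \<Rightarrow> (real ^ 'n) set \<Rightarrow> (real ^ 'n) \<times> 'y \<times> 'u \<Rightarrow> real"
  where "penalty_objective F f Uad A B P \<gamma> T = (\<lambda>(\<beta>, y, u).
    F (\<beta>, y, u) + \<gamma> * P (f (\<beta>, y, u) - affine_interp (phi f Uad A B) T \<beta>))"

definition penalty_feasible ::
  "'u::real_normed_vector set \<Rightarrow> ('y::real_normed_vector \<Rightarrow>\<^sub>L 'z::real_normed_vector) \<Rightarrow>
   ('u \<Rightarrow>\<^sub>L 'z) \<Rightarrow> (real ^ 'n) set \<Rightarrow> (real ^ 'n) \<times> 'y \<times> 'u \<Rightarrow> bool"
  where "penalty_feasible Uad A B T = (\<lambda>(\<beta>, y, u).
    \<beta> \<in> T \<and> blinfun_apply A y - blinfun_apply B u = 0 \<and> u \<in> Uad)"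

text \<open>
  The subdivision \<open>\<T>'\<close> arises from \<open>\<T>\<close> by replacing \<open>T0\<close> with the members of \<open>R\<close>.
  The condition \<open>T0 \<notin> R\<close> excludes the void refinement, for which the volume and shape
  conditions on \<open>\<T>' - \<T>\<close> would say nothing.
\<close>

definition refinement_step ::
  "real \<Rightarrow> real \<Rightarrow> (real ^ 'n) set set \<Rightarrow> (real ^ 'n) set \<Rightarrow> (real ^ 'n) set set \<Rightarrow> bool"
  where "refinement_step q \<rho> \<T> T0 \<T>' \<longleftrightarrow>
    (\<exists>R. subdivision T0 R \<and> T0 \<notin> R \<and> \<T>' = (\<T> - {T0}) \<union> R) \<and>
    (\<forall>T\<in>\<T>' - \<T>. measure lebesgue T \<le> q * measure lebesgue T0 \<and> \<rho> \<le> shape_ratio T)"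

definition stop_test ::
  "('b \<times> 'y::real_normed_vector \<times> 'u::real_normed_vector \<Rightarrow> real) \<Rightarrow> 'u set \<Rightarrow>
   ('y \<Rightarrow>\<^sub>L 'z::real_normed_vector) \<Rightarrow> ('u \<Rightarrow>\<^sub>L 'z) \<Rightarrow> 'b \<times> 'y \<times> 'u \<Rightarrow> bool"
  where "stop_test f Uad A B = (\<lambda>(\<beta>, y, u). f (\<beta>, y, u) = phi f Uad A B \<beta>)"

text \<open>
  A run of the algorithm, with iterations numbered from \<open>1\<close>. In iteration \<open>k\<close> the subdivision
  is \<open>\<T> k\<close>, the penalty parameter and the computed point belonging to \<open>T \<in> \<T> k\<close> are
  \<open>\<gamma> k T\<close> and \<open>w k T\<close>, and the selected simplex is \<open>Tbar k\<close>; the iterate is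
  \<open>w k (Tbar k)\<close>. The sequences are total functions, but they are constrained only in those
  iterations that are reached, that is, before which the algorithm has not stopped.
\<close>

definition reached ::
  "('b \<times> 'y::real_normed_vector \<times> 'u::real_normed_vector \<Rightarrow> real) \<Rightarrow> 'u set \<Rightarrow>
   ('y \<Rightarrow>\<^sub>L 'z::real_normed_vector) \<Rightarrow> ('u \<Rightarrow>\<^sub>L 'z) \<Rightarrow> (nat \<Rightarrow> 'b \<times> 'y \<times> 'u) \<Rightarrow> nat \<Rightarrow> bool"
  where "reached f Uad A B x k \<longleftrightarrow>
    1 \<le> k \<and> (\<forall>j. 1 \<le> j \<and> j < k \<longrightarrow> \<not> stop_test f Uad A B (x j))"

definition penalty_algorithm_run ::
  "(real ^ 'n) set \<Rightarrow> ((real ^ 'n) \<times> 'y::real_normed_vector \<times> 'u::real_normed_vector \<Rightarrow> real) \<Rightarrow>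
   ((real ^ 'n) \<times> 'y \<times> 'u \<Rightarrow> real) \<Rightarrow> 'u set \<Rightarrow>
   ('y \<Rightarrow>\<^sub>L 'z::real_normed_vector) \<Rightarrow> ('u \<Rightarrow>\<^sub>L 'z) \<Rightarrow> (real \<Rightarrow> real) \<Rightarrow> real \<Rightarrow> real \<Rightarrow>
   (nat \<Rightarrow> (real ^ 'n) set set) \<Rightarrow> (nat \<Rightarrow> (real ^ 'n) set \<Rightarrow> real) \<Rightarrow>
   (nat \<Rightarrow> (real ^ 'n) set \<Rightarrow> (real ^ 'n) \<times> 'y \<times> 'u) \<Rightarrow> (nat \<Rightarrow> (real ^ 'n) set) \<Rightarrow> bool"
  where "penalty_algorithm_run Q F f Uad A B P q \<rho> \<T> \<gamma> w Tbar \<longleftrightarrow>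
    subdivision Q (\<T> 1) \<and>
    0 < q \<and> q < 1 \<and> 0 < \<rho> \<and> \<rho> < 1 \<and> (\<forall>T\<in>\<T> 1. \<rho> \<le> shape_ratio T) \<and>
    mono P \<and> P 0 = 0 \<and>
    (\<forall>k. reached f Uad A B (\<lambda>j. w j (Tbar j)) k \<longrightarrow>
      (\<forall>T\<in>\<T> k. 0 < \<gamma> k T \<and>
        is_arg_min (penalty_objective F f Uad A B P (\<gamma> k T) T) (penalty_feasible Uad A B T) (w k T)) \<and>
      is_arg_min (\<lambda>T. penalty_objective F f Uad A B P (\<gamma> k T) T (w k T)) (\<lambda>T. T \<in> \<T> k) (Tbar k) \<and>
      (\<not> stop_test f Uad A B (w k (Tbar k)) \<longrightarrow>
        refinement_step q \<rho> (\<T> k) (Tbar k) (\<T> (Suc k))))"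

end

theory Submission
  imports Defs "HOL-Library.Multiset_Order"
begin

text \<open>
  Eliminating the state by \<open>y = S u\<close> turns the lower-level problem into the minimization over
  \<open>u \<in> Uad\<close> of the reduced objective \<open>G \<beta> u = f (\<beta>, S u, u)\<close>, which is strongly convex in \<open>u\<close>
  uniformly in \<open>\<beta>\<close>. Hence it has a unique minimizer \<open>sol \<beta>\<close>, every \<open>u\<close> satisfies
  \<open>\<mu> / 4 * norm (u - sol \<beta>)^2 \<le> G \<beta> u - \<phi> \<beta>\<close> (\<open>quadratic_growth\<close>), and both \<open>sol\<close> and the optimal value
  \<open>\<phi>\<close> are continuous on \<open>Q\<close>. Moreover \<open>\<phi>\<close> is convex, because \<open>f\<close> is convex jointly in all arguments.

  Convexity gives \<open>\<phi> \<le> \<xi>\<^sub>T\<close> on every simplex \<open>T\<close>. A feasible point of (OVR) therefore pays no penalty in a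
  simplex that contains its parameter, so the penalty value of each iterate is at most the optimal value
  of (OVR) (\<open>penalty_value_le_feasible_value\<close>). This settles the case of finite termination, where the
  iterate is itself feasible and pays no penalty either.

  If the algorithm runs forever, the diameters of the selected simplices tend to zero. Their volumes do,
  because only finitely many steps can refine a simplex of volume at least \<open>\<epsilon>\<close>: each such step
  replaces one member of the subdivision, and among the finitely many new members those of volume at
  least \<open>\<epsilon>\<close> have a strictly lower logarithmic volume level; the multiset order on natural numbers is well-founded
  (\<open>selected_volume_tendsto_zero\<close>). The lower bound on the shape ratio converts volume into diameter
  (\<open>diameter_power_le_volume\<close>). By uniform continuity of \<open>\<phi>\<close> the interpolant at the iterate then
  exceeds \<open>\<phi>\<close> by an arbitrarily small amount only. Since the penalty term is bounded while the penalty
  parameter grows beyond all bounds, the optimality gap \<open>f (\<beta>\<^sub>k, y\<^sub>k, u\<^sub>k) - \<phi> \<beta>\<^sub>k\<close> tends to zero, and quadratic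
  growth yields \<open>u\<^sub>k - sol \<beta>\<^sub>k \<longlonglongrightarrow> 0\<close> in norm. Compactness of \<open>Q\<close> provides a convergent subsequence of the
  parameters, continuity of \<open>sol\<close> makes the controls and states converge strongly along it, and the limit
  is feasible with a value not exceeding that of any feasible point. Since every subsequence has such a
  cluster point, uniqueness of the solution gives convergence of the whole sequence.
\<close>

section \<open>Value functions of strongly convex families\<close>

text \<open>
  In the application \<open>G \<beta>\<close> is the reduced objective and \<open>D \<beta> u\<close> its derivative in the control; the
  inequality \<open>strong_convexity\<close> says that \<open>D \<beta> u\<close> is a subgradient of \<open>G \<beta>\<close> at \<open>u\<close>
  relative to \<open>U\<close>, with a quadratic surplus.
\<close>

locale strongly_convex_family =
  fixes Q :: "'b::real_normed_vector set"
    and U :: "'u::{real_normed_vector, complete_space} set"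
    and G :: "'b \<Rightarrow> 'u \<Rightarrow> real"
    and D :: "'b \<Rightarrow> 'u \<Rightarrow> 'u \<Rightarrow>\<^sub>L real"
    and \<mu> :: real
  assumes U_nonempty: "U \<noteq> {}" and U_closed: "closed U" and U_convex: "convex U"
    and bounded_below: "\<beta> \<in> Q \<Longrightarrow> bdd_below (G \<beta> ` U)"
    and G_continuous: "continuous_on (Q \<times> U) (\<lambda>(\<beta>, u). G \<beta> u)"
    and D_continuous: "continuous_on (Q \<times> U) (\<lambda>(\<beta>, u). D \<beta> u)"
    and modulus_pos: "0 < \<mu>"
    and strong_convexity: "\<lbrakk>\<beta> \<in> Q; u \<in> U; v \<in> U\<rbrakk> \<Longrightarrow>
      G \<beta> u + D \<beta> u (v - u) + \<mu> / 2 * (norm (v - u))\<^sup>2 \<le> G \<beta> v"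
begin

definition val :: "'b \<Rightarrow> real"
  where "val \<beta> = (INF u\<in>U. G \<beta> u)"

lemma val_le: "\<beta> \<in> Q \<Longrightarrow> u \<in> U \<Longrightarrow> val \<beta> \<le> G \<beta> u"
  unfolding val_def by (rule cINF_lower[OF bounded_below])

lemma G_continuous_in_u:
  assumes "\<beta> \<in> Q" shows "continuous_on U (G \<beta>)"
  using continuous_on_compose2[OF G_continuous, of U "\<lambda>u. (\<beta>, u)"]
    continuous_on_Pair[OF continuous_on_const continuous_on_id, of U \<beta>] assms
  by (auto simp: image_subset_iff)

lemma D_continuous_in_u:
  assumes "\<beta> \<in> Q" shows "continuous_on U (D \<beta>)"
  using continuous_on_compose2[OF D_continuous, of U "\<lambda>u. (\<beta>, u)"]
    continuous_on_Pair[OF continuous_on_const continuous_on_id, of U \<beta>] assms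
  by (auto simp: image_subset_iff)

lemma D_continuous_in_parameter:
  assumes "u \<in> U" shows "continuous_on Q (\<lambda>\<beta>. D \<beta> u)"
  using continuous_on_compose2[OF D_continuous, of Q "\<lambda>\<beta>. (\<beta>, u)"]
    continuous_on_Pair[OF continuous_on_id continuous_on_const, of Q u] assms
  by (auto simp: image_subset_iff)

text \<open>
  Strong convexity is used at the midpoint of \<open>u\<close> and \<open>v\<close>: the two linear terms cancel, and the value
  at the midpoint is at least the optimal value. This estimate makes minimizing sequences
  Cauchy and shows that minimizers are unique.
\<close>

lemma near_minimizers_close:
  assumes \<beta>: "\<beta> \<in> Q" and u: "u \<in> U" and v: "v \<in> U"
  shows "\<mu> / 4 * (norm (v - u))\<^sup>2 \<le> (G \<beta> u - val \<beta>) + (G \<beta> v - val \<beta>)"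
proof -
  define d where "d = (1/2) *\<^sub>R (v - u)"
  define m where "m = (1/2) *\<^sub>R u + (1/2) *\<^sub>R v"
  have m: "m \<in> U"
    unfolding m_def using convexD[OF U_convex u v, of "1/2" "1/2"] by simp
  have half: "(1/2) *\<^sub>R z - z = - ((1/2) *\<^sub>R z)" for z :: 'u
    using scaleR_left_diff_distrib[of "1/2" 1 z] by simp
  have v': "v - m = d" and u': "u - m = - d"
    using half[of v] half[of u] by (simp_all add: d_def m_def algebra_simps)
  have nd: "(norm d)\<^sup>2 = (norm (v - u))\<^sup>2 / 4"
    by (simp add: d_def power_mult_distrib power_divide)
  have "G \<beta> m + D \<beta> m d + \<mu> / 2 * (norm d)\<^sup>2 \<le> G \<beta> v"
    using strong_convexity[OF \<beta> m v] by (simp add: v')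
  moreover have "G \<beta> m - D \<beta> m d + \<mu> / 2 * (norm d)\<^sup>2 \<le> G \<beta> u"
    using strong_convexity[OF \<beta> m u] by (simp add: u' blinfun.minus_right)
  moreover have "val \<beta> \<le> G \<beta> m"
    using val_le[OF \<beta> m] .
  ultimately show ?thesis
    by (simp add: nd)
qed

lemma minimizer_exists:
  assumes \<beta>: "\<beta> \<in> Q"
  shows "\<exists>u\<in>U. G \<beta> u = val \<beta>"
proof -
  have "\<exists>u\<in>U. G \<beta> u < val \<beta> + 1 / real (Suc n)" for n
    using cInf_lessD[of "G \<beta> ` U" "val \<beta> + 1 / real (Suc n)"] U_nonempty
    by (auto simp: val_def)
  then obtain u where u: "\<And>n. u n \<in> U" and G: "\<And>n. G \<beta> (u n) < val \<beta> + 1 / real (Suc n)"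
    by metis
  have "Cauchy u"
  proof (rule metric_CauchyI)
    fix e :: real assume e: "0 < e"
    obtain N where N: "inverse (real (Suc N)) < \<mu> * e\<^sup>2 / 8"
      using reals_Archimedean[of "\<mu> * e\<^sup>2 / 8"] e modulus_pos by auto
    have gap: "G \<beta> (u n) - val \<beta> < \<mu> * e\<^sup>2 / 8" if "N \<le> n" for n
    proof -
      have "1 / real (Suc n) \<le> inverse (real (Suc N))"
        using that by (simp add: field_simps)
      then show ?thesis using G[of n] N by linarith
    qed
    show "\<exists>M. \<forall>m\<ge>M. \<forall>n\<ge>M. dist (u m) (u n) < e"
    proof (intro exI[of _ N] allI impI)
      fix m n assume mn: "N \<le> m" "N \<le> n"
      have "\<mu> / 4 * (norm (u m - u n))\<^sup>2 < \<mu> / 4 * e\<^sup>2"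
        using near_minimizers_close[OF \<beta> u u, of m n] gap[OF mn(1)] gap[OF mn(2)]
        by linarith
      then have "(norm (u m - u n))\<^sup>2 < e\<^sup>2"
        using modulus_pos by simp
      then show "dist (u m) (u n) < e"
        using e by (simp add: dist_norm power_less_imp_less_base)
    qed
  qed
  then obtain l where l: "u \<longlonglongrightarrow> l"
    using Cauchy_convergent convergent_def by blast
  have lU: "l \<in> U"
    using closed_sequentially[OF U_closed _ l] u by blast
  have "(\<lambda>n. G \<beta> (u n)) \<longlonglongrightarrow> G \<beta> l"
    using continuous_on_tendsto_compose[OF G_continuous_in_u[OF \<beta>] l lU] u by simp
  moreover have "(\<lambda>n. val \<beta> + 1 / real (Suc n)) \<longlonglongrightarrow> val \<beta> + 0"
    using LIMSEQ_inverse_real_of_nat by (intro tendsto_intros) (simp add: inverse_eq_divide)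
  ultimately have "G \<beta> l \<le> val \<beta> + 0"
    by (rule LIMSEQ_le) (use G less_imp_le in blast)
  with val_le[OF \<beta> lU] lU show ?thesis
    by auto
qed

definition sol :: "'b \<Rightarrow> 'u"
  where "sol \<beta> = (SOME u. u \<in> U \<and> G \<beta> u = val \<beta>)"

lemma
  assumes "\<beta> \<in> Q"
  shows sol_in: "sol \<beta> \<in> U" and G_sol: "G \<beta> (sol \<beta>) = val \<beta>"
  using someI_ex[of "\<lambda>u. u \<in> U \<and> G \<beta> u = val \<beta>"] minimizer_exists[OF assms]
  unfolding sol_def by blast+

lemma quadratic_growth:
  assumes "\<beta> \<in> Q" "u \<in> U"
  shows "\<mu> / 4 * (norm (u - sol \<beta>))\<^sup>2 \<le> G \<beta> u - val \<beta>"
  using near_minimizers_close[OF assms(1) sol_in[OF assms(1)] assms(2)] G_sol[OF assms(1)] by simp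

text \<open>
  At the points \<open>z\<close> of the segment from \<open>sol \<beta>\<close> to \<open>v\<close>, optimality of \<open>sol \<beta>\<close> and the subgradient inequality
  give \<open>D \<beta> z (v - sol \<beta>) \<ge> 0\<close>; continuity of \<open>D \<beta>\<close> carries this over to \<open>z = sol \<beta>\<close>.
\<close>

lemma variational_inequality:
  assumes \<beta>: "\<beta> \<in> Q" and v: "v \<in> U"
  shows "0 \<le> D \<beta> (sol \<beta>) (v - sol \<beta>)"
proof -
  define d where "d = v - sol \<beta>"
  define t where "t n = inverse (real (Suc n))" for n
  define z where "z n = sol \<beta> + t n *\<^sub>R d" for n
  have t: "0 < t n" "t n \<le> 1" for n
    by (simp_all add: t_def field_simps)
  have z: "z n \<in> U" for n
  proof -
    have "z n = (1 - t n) *\<^sub>R sol \<beta> + t n *\<^sub>R v"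
      by (simp add: z_def d_def algebra_simps)
    then show ?thesis
      using convexD[OF U_convex sol_in[OF \<beta>] v, of "1 - t n" "t n"] t[of n] by simp
  qed
  have pos: "0 \<le> D \<beta> (z n) d" for n
  proof -
    have "sol \<beta> - z n = - (t n *\<^sub>R d)"
      by (simp add: z_def)
    then have "G \<beta> (z n) + D \<beta> (z n) (- (t n *\<^sub>R d)) \<le> G \<beta> (sol \<beta>)"
      using strong_convexity[OF \<beta> z sol_in[OF \<beta>], of n] modulus_pos
        zero_le_power2[of "norm (sol \<beta> - z n)"]
      by (smt (verit, best) divide_pos_pos mult_nonneg_nonneg)
    then have "G \<beta> (z n) - t n * D \<beta> (z n) d \<le> G \<beta> (sol \<beta>)"
      by (simp add: blinfun.minus_right blinfun.scaleR_right)
    then have "0 \<le> t n * D \<beta> (z n) d"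
      using val_le[OF \<beta> z, of n] G_sol[OF \<beta>] by simp
    then show ?thesis
      using t(1)[of n] by (simp add: zero_le_mult_iff)
  qed
  have "z \<longlonglongrightarrow> sol \<beta> + 0 *\<^sub>R d"
    unfolding z_def t_def using LIMSEQ_inverse_real_of_nat by (intro tendsto_intros)
  then have zlim: "z \<longlonglongrightarrow> sol \<beta>" by simp
  have "(\<lambda>n. D \<beta> (z n)) \<longlonglongrightarrow> D \<beta> (sol \<beta>)"
    using continuous_on_tendsto_compose[OF D_continuous_in_u[OF \<beta>] zlim sol_in[OF \<beta>]] z by simp
  then have "(\<lambda>n. D \<beta> (z n) d) \<longlonglongrightarrow> D \<beta> (sol \<beta>) d"
    by (intro tendsto_intros)
  then show ?thesis
    unfolding d_def[symmetric] by (rule LIMSEQ_le_const) (use pos in blast)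
qed

text \<open>
  The increment \<open>d = sol \<beta>' - sol \<beta>\<close> satisfies \<open>\<mu> / 2 * norm d ^ 2 \<le> - D \<beta>' (sol \<beta>) d\<close>, since moving from
  \<open>sol \<beta>\<close> to \<open>sol \<beta>'\<close> does not increase \<open>G \<beta>'\<close>. Adding the variational inequality at \<open>\<beta>\<close> leaves only
  the difference of the two derivatives at the same control \<open>sol \<beta>\<close>, so continuity of \<open>D\<close> in the parameter
  yields continuity of \<open>sol\<close>.
\<close>

lemma sol_stability:
  assumes \<beta>: "\<beta> \<in> Q" and \<beta>': "\<beta>' \<in> Q"
  shows "norm (sol \<beta>' - sol \<beta>) \<le> 2 / \<mu> * norm (D \<beta>' (sol \<beta>) - D \<beta> (sol \<beta>))"
proof -
  define d where "d = sol \<beta>' - sol \<beta>"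
  define E where "E = D \<beta>' (sol \<beta>) - D \<beta> (sol \<beta>)"
  have "\<mu> / 2 * (norm d)\<^sup>2 \<le> - D \<beta>' (sol \<beta>) d"
    using strong_convexity[OF \<beta>' sol_in[OF \<beta>] sol_in[OF \<beta>']]
      val_le[OF \<beta>' sol_in[OF \<beta>]] G_sol[OF \<beta>']
    unfolding d_def by linarith
  also have "\<dots> \<le> - E d"
    using variational_inequality[OF \<beta> sol_in[OF \<beta>']]
    by (simp add: d_def E_def blinfun.diff_left)
  also have "\<dots> \<le> norm E * norm d"
    using norm_blinfun[of E d] by simp
  finally have "(\<mu> / 2 * norm d) * norm d \<le> norm E * norm d"
    by (simp add: power2_eq_square)
  then have "\<mu> / 2 * norm d \<le> norm E"
    by (cases "norm d = 0") (use mult_right_le_imp_le in fastforce)+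
  then show ?thesis
    using modulus_pos by (simp add: d_def E_def field_simps)
qed

lemma sol_continuous: "continuous_on Q sol"
  unfolding continuous_on_def
proof
  fix \<beta> assume \<beta>: "\<beta> \<in> Q"
  have "((\<lambda>\<beta>'. D \<beta>' (sol \<beta>)) \<longlongrightarrow> D \<beta> (sol \<beta>)) (at \<beta> within Q)"
    using D_continuous_in_parameter[OF sol_in[OF \<beta>]] \<beta> by (simp add: continuous_on_def)
  then have "((\<lambda>\<beta>'. D \<beta>' (sol \<beta>) - D \<beta> (sol \<beta>)) \<longlongrightarrow> 0) (at \<beta> within Q)"
    by (simp add: LIM_zero_iff)
  then have "((\<lambda>\<beta>'. 2 / \<mu> * norm (D \<beta>' (sol \<beta>) - D \<beta> (sol \<beta>))) \<longlongrightarrow> 0) (at \<beta> within Q)"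
    by (intro tendsto_mult_right_zero tendsto_norm_zero)
  then have "((\<lambda>\<beta>'. sol \<beta>' - sol \<beta>) \<longlongrightarrow> 0) (at \<beta> within Q)"
    by (rule Lim_null_comparison[rotated])
      (use sol_stability[OF \<beta>] in \<open>auto simp: eventually_at_filter\<close>)
  then show "(sol \<longlongrightarrow> sol \<beta>) (at \<beta> within Q)"
    by (simp add: LIM_zero_iff)
qed

lemma val_continuous: "continuous_on Q val"
proof -
  have "continuous_on Q (\<lambda>\<beta>. G \<beta> (sol \<beta>))"
    using continuous_on_compose2[OF G_continuous, of Q "\<lambda>\<beta>. (\<beta>, sol \<beta>)"]
      continuous_on_Pair[OF continuous_on_id sol_continuous] sol_in
    by (auto simp: image_subset_iff)
  then show ?thesis
    by (rule continuous_on_eq) (rule G_sol)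
qed

text \<open>
  The convex combination of two minimizers is a competitor for the combined parameter.
\<close>

lemma val_convex:
  assumes "convex_on (Q \<times> U) (\<lambda>(\<beta>, u). G \<beta> u)"
  shows "convex_on Q val"
proof -
  have "convex (Q \<times> U)"
    using assms convex_on_imp_convex by blast
  then have "convex (fst ` (Q \<times> U))"
    by (rule convex_linear_image[OF linear_fst])
  then have Qc: "convex Q"
    using U_nonempty by (simp add: fst_image_times)
  show ?thesis
  proof (rule convex_onI[OF _ Qc])
    fix t :: real and b c assume t: "0 < t" "t < 1" and b: "b \<in> Q" and c: "c \<in> Q"
    define m where "m = (1 - t) *\<^sub>R b + t *\<^sub>R c"
    define s where "s = (1 - t) *\<^sub>R sol b + t *\<^sub>R sol c"
    have m: "m \<in> Q" unfolding m_def using convexD[OF Qc b c, of "1 - t" t] t by simp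
    have s: "s \<in> U" unfolding s_def
      using convexD[OF U_convex sol_in[OF b] sol_in[OF c], of "1 - t" t] t by simp
    have "val m \<le> G m s"
      by (rule val_le[OF m s])
    also have "\<dots> \<le> (1 - t) * G b (sol b) + t * G c (sol c)"
      using convex_onD[OF assms, of t "(b, sol b)" "(c, sol c)"] t b c sol_in
      by (simp add: m_def s_def)
    finally show "val ((1 - t) *\<^sub>R b + t *\<^sub>R c) \<le> (1 - t) * val b + t * val c"
      by (simp add: m_def G_sol[OF b] G_sol[OF c])
  qed
qed

text \<open>
  Quadratic growth gives strong convergence although the parameter varies along the sequence: \<open>u k\<close>
  approaches \<open>sol (\<beta> k)\<close>, which converges by continuity of \<open>sol\<close>.
\<close>

lemma minimizing_sequence_tendsto:
  assumes \<beta>: "\<And>k. \<beta> k \<in> Q" and u: "\<And>k. u k \<in> U"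
    and lim: "\<beta> \<longlonglongrightarrow> b" "b \<in> Q"
    and gap: "(\<lambda>k. G (\<beta> k) (u k) - val (\<beta> k)) \<longlonglongrightarrow> 0"
  shows "u \<longlonglongrightarrow> sol b"
proof -
  have "(\<lambda>k. 4 / \<mu> * (G (\<beta> k) (u k) - val (\<beta> k))) \<longlonglongrightarrow> 0"
    by (intro tendsto_mult_right_zero gap)
  then have "(\<lambda>k. (norm (u k - sol (\<beta> k)))\<^sup>2) \<longlonglongrightarrow> 0"
    by (rule Lim_null_comparison[rotated])
      (use quadratic_growth[OF \<beta> u] modulus_pos in
        \<open>auto intro!: always_eventually simp: field_simps\<close>)
  then have "(\<lambda>k. u k - sol (\<beta> k)) \<longlonglongrightarrow> 0"
    using tendsto_norm_zero_cancel power_tendsto_0_iff[of 2] by auto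
  moreover have "(\<lambda>k. sol (\<beta> k)) \<longlonglongrightarrow> sol b"
    using continuous_on_tendsto_compose[OF sol_continuous lim] \<beta> by simp
  ultimately show ?thesis
    using tendsto_add[of "\<lambda>k. u k - sol (\<beta> k)" 0 sequentially "\<lambda>k. sol (\<beta> k)" "sol b"] by simp
qed

end

section \<open>Affine interpolation on simplices\<close>

lemma affine_function_determined:
  fixes \<xi> \<eta> :: "'a::euclidean_space \<Rightarrow> real"
  assumes "\<xi> = (\<lambda>x. a \<bullet> x + c)" "\<eta> = (\<lambda>x. b \<bullet> x + d)"
    and agree: "\<And>v. v \<in> V \<Longrightarrow> \<xi> v = \<eta> v" and full: "affine hull V = UNIV"
  shows "\<xi> = \<eta>"
proof -
  have "affine {x. (a - b) \<bullet> x = d - c}"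
    by (rule affine_hyperplane)
  moreover have "V \<subseteq> {x. (a - b) \<bullet> x = d - c}"
    using agree by (fastforce simp: assms(1,2) inner_diff_left)
  ultimately have "affine hull V \<subseteq> {x. (a - b) \<bullet> x = d - c}"
    by (rule hull_minimal[rotated])
  then show ?thesis
    by (auto simp: full assms(1,2) inner_diff_left fun_eq_iff algebra_simps)
qed

text \<open>
  Relative to a base vertex \<open>p\<close>, the remaining vertices are linearly independent, so a linear functional
  with the values \<open>g v - g p\<close> exists; its inner product representation is \<open>adjoint h 1\<close>.
\<close>

lemma affine_function_exists:
  fixes g :: "'a::euclidean_space \<Rightarrow> real"
  assumes V: "\<not> affine_dependent V"
  shows "\<exists>a c. \<forall>v\<in>V. a \<bullet> v + c = g v"
proof (cases "V = {}")
  case False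
  then obtain p where p: "p \<in> V" by blast
  define V' where "V' = V - {p}"
  have V': "V = insert p V'" "p \<notin> V'"
    using p by (auto simp: V'_def)
  have indep: "independent ((\<lambda>v. - p + v) ` V')"
    using affine_dependent_iff_dependent[OF V'(2)] V unfolding V'(1) by blast
  obtain h :: "'a \<Rightarrow> real" where h: "linear h"
    and hv: "\<forall>y \<in> (\<lambda>v. - p + v) ` V'. h y = g (p + y) - g p"
    using linear_independent_extend[OF indep, of "\<lambda>y. g (p + y) - g p"] by blast
  define a where "a = adjoint h 1"
  have a: "a \<bullet> y = h y" for y
    using adjoint_works[OF h, of y 1] by (simp add: a_def inner_commute)
  have "a \<bullet> v + (g p - a \<bullet> p) = g v" if "v \<in> V" for v
  proof (cases "v = p")
    case False
    with that V' have "v \<in> V'" by blast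
    then have "a \<bullet> (- p + v) = g v - g p"
      using hv by (simp add: a)
    then show ?thesis by (simp add: inner_diff_right)
  qed simp
  then show ?thesis by blast
qed simp

text \<open>
  Describes the definite description behind \<open>affine_interp\<close>: an affine function with prescribed values at
  the vertices exists since these are affinely independent, and is unique since they affinely
  span the whole space.
\<close>

lemma affine_interp_on_simplex:
  fixes T :: "(real ^ 'n) set"
  assumes T: "int CARD('n) simplex T"
  shows "\<exists>V a c. T = convex hull V \<and> affine_interp g T = (\<lambda>x. a \<bullet> x + c) \<and>
    (\<forall>v\<in>V. affine_interp g T v = g v)"
proof -
  obtain V where V: "\<not> affine_dependent V" "int (card V) = int CARD('n) + 1" "T = convex hull V"
    using T unfolding simplex by blast
  have "aff_dim V = int DIM(real ^ 'n)"
    using aff_dim_affine_independent[OF V(1)] V(2) by simp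
  then have full: "affine hull V = UNIV"
    by (simp only: aff_dim_eq_full)
  have ext: "v extreme_point_of T \<longleftrightarrow> v \<in> V" for v
    unfolding V(3) by (rule extreme_point_of_convex_hull_affine_independent[OF V(1)])
  obtain a c where ac: "\<forall>v\<in>V. a \<bullet> v + c = g v"
    using affine_function_exists[OF V(1)] by blast
  have "affine_interp g T = (\<lambda>x. a \<bullet> x + c)"
    unfolding affine_interp_def ext
  proof (rule the_equality)
    show "(\<exists>a' c'. (\<lambda>x. a \<bullet> x + c) = (\<lambda>x. a' \<bullet> x + c')) \<and> (\<forall>v. v \<in> V \<longrightarrow> a \<bullet> v + c = g v)"
      using ac by blast
  next
    fix \<xi> assume \<xi>: "(\<exists>a' c'. \<xi> = (\<lambda>x. a' \<bullet> x + c')) \<and> (\<forall>v. v \<in> V \<longrightarrow> \<xi> v = g v)"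
    then obtain a' c' where "\<xi> = (\<lambda>x. a' \<bullet> x + c')" by blast
    then show "\<xi> = (\<lambda>x. a \<bullet> x + c)"
      by (rule affine_function_determined[OF _ refl _ full]) (use \<xi> ac in simp)
  qed
  with V(3) ac show ?thesis
    by (intro exI[of _ V] exI[of _ a] exI[of _ c]) simp
qed

text \<open>
  The set where \<open>g\<close> lies below its interpolant is convex and contains the vertices.
\<close>

lemma convex_le_affine_interp:
  fixes T :: "(real ^ 'n) set"
  assumes T: "int CARD('n) simplex T" and g: "convex_on T g" and x: "x \<in> T"
  shows "g x \<le> affine_interp g T x"
proof -
  obtain V a c where V: "T = convex hull V" "affine_interp g T = (\<lambda>x. a \<bullet> x + c)"
    "\<forall>v\<in>V. affine_interp g T v = g v"
    using affine_interp_on_simplex[OF T, of g] by blast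
  let ?D = "{y \<in> T. g y \<le> affine_interp g T y}"
  have "convex ?D"
  proof (rule convexI, clarify, intro conjI)
    fix y z and s t :: real
    assume y: "y \<in> T" "g y \<le> affine_interp g T y" and z: "z \<in> T" "g z \<le> affine_interp g T z"
      and st: "0 \<le> s" "0 \<le> t" "s + t = 1"
    show "s *\<^sub>R y + t *\<^sub>R z \<in> T"
      using convexD[OF convex_simplex[OF T] y(1) z(1) st] .
    have "g (s *\<^sub>R y + t *\<^sub>R z) \<le> s * g y + t * g z"
      using g y(1) z(1) st unfolding convex_on_def by blast
    also have "\<dots> \<le> s * affine_interp g T y + t * affine_interp g T z"
      using y z st by (intro add_mono mult_left_mono) auto
    also have "\<dots> = a \<bullet> (s *\<^sub>R y + t *\<^sub>R z) + (s + t) * c"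
      unfolding V(2) by (simp add: inner_add_right algebra_simps)
    finally show "g (s *\<^sub>R y + t *\<^sub>R z) \<le> affine_interp g T (s *\<^sub>R y + t *\<^sub>R z)"
      unfolding V(2) st(3) by simp
  qed
  moreover have "V \<subseteq> ?D"
    using V(3) hull_subset[of V convex] unfolding V(1) by force
  ultimately have "convex hull V \<subseteq> ?D"
    by (rule hull_minimal[rotated])
  with x V(1) show ?thesis by blast
qed

text \<open>
  An affine function attains its maximum over a simplex at a vertex.
\<close>

lemma affine_interp_le:
  fixes T :: "(real ^ 'n) set"
  assumes T: "int CARD('n) simplex T" and g: "\<And>v. v \<in> T \<Longrightarrow> g v \<le> K" and x: "x \<in> T"
  shows "affine_interp g T x \<le> K"
proof -
  obtain V a c where V: "T = convex hull V" "affine_interp g T = (\<lambda>x. a \<bullet> x + c)"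
    "\<forall>v\<in>V. affine_interp g T v = g v"
    using affine_interp_on_simplex[OF T, of g] by blast
  have "a \<bullet> v \<le> K - c" if "v \<in> V" for v
  proof -
    have "v \<in> T"
      unfolding V(1) using that by (rule hull_inc)
    then have "a \<bullet> v + c \<le> K"
      using g[of v] bspec[OF V(3) that] unfolding V(2) by simp
    then show ?thesis by simp
  qed
  then have "V \<subseteq> {y. a \<bullet> y \<le> K - c}" by blast
  then have "convex hull V \<subseteq> {y. a \<bullet> y \<le> K - c}"
    by (intro hull_minimal convex_halfspace_le)
  with x have "a \<bullet> x \<le> K - c"
    unfolding V(1) by blast
  then show ?thesis
    unfolding V(2) by simp
qed

text \<open>
  All vertices of \<open>T k\<close> are close to \<open>\<beta> k\<close>, and \<open>g\<close> is uniformly continuous on the compact set \<open>Q\<close>.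
\<close>

lemma affine_interp_near:
  fixes T :: "nat \<Rightarrow> (real ^ 'n) set"
  assumes Q: "compact Q" and g: "continuous_on Q g"
    and T: "\<And>k. int CARD('n) simplex T k" "\<And>k. T k \<subseteq> Q" and \<beta>: "\<And>k. \<beta> k \<in> T k"
    and diam: "(\<lambda>k. diameter (T k)) \<longlonglongrightarrow> 0" and \<epsilon>: "0 < \<epsilon>"
  shows "\<forall>\<^sub>F k in sequentially. affine_interp g (T k) (\<beta> k) \<le> g (\<beta> k) + \<epsilon>"
proof -
  have "uniformly_continuous_on Q g"
    using compact_uniformly_continuous[OF g Q] .
  then obtain \<delta> where \<delta>: "0 < \<delta>" "\<And>a b. a \<in> Q \<Longrightarrow> b \<in> Q \<Longrightarrow> dist b a < \<delta> \<Longrightarrow> dist (g b) (g a) < \<epsilon>"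
    unfolding uniformly_continuous_on_def using \<epsilon> by meson
  have "\<forall>\<^sub>F k in sequentially. diameter (T k) < \<delta>"
    using order_tendstoD(2)[OF diam \<delta>(1)] .
  then show ?thesis
  proof eventually_elim
    case (elim k)
    have "g v \<le> g (\<beta> k) + \<epsilon>" if v: "v \<in> T k" for v
    proof -
      have "dist v (\<beta> k) \<le> diameter (T k)"
        using diameter_bounded_bound[OF compact_imp_bounded[OF compact_simplex[OF T(1)]] v \<beta>] .
      then have "dist (g v) (g (\<beta> k)) < \<epsilon>"
        using elim v \<beta>[of k] T(2)[of k] by (intro \<delta>(2)) auto
      then show ?thesis by (simp add: dist_real_def)
    qed
    then show ?case
      by (rule affine_interp_le[OF T(1) _ \<beta>])
  qed
qed

section \<open>Shrinking of the selected simplices\<close>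

text \<open>
  Centres and radii of the balls contained in \<open>T\<close> form a compact set, on which the radius attains its
  maximum. This makes the choice in \<open>shape_ratio\<close> meaningful.
\<close>

lemma largest_ball_exists:
  fixes T :: "(real ^ 'n) set"
  assumes T: "compact T" "T \<noteq> {}"
  shows "\<exists>S. is_largest_ball S T"
proof -
  \<comment> \<open>In terms of the unit ball, containment in \<open>T\<close> is a closed condition on centre and radius.\<close>
  define K where "K = (\<Inter>v\<in>cball 0 1. (\<lambda>p. fst p + snd p *\<^sub>R v) -` T) \<inter> {p. 0 \<le> snd p}"
  have K_iff: "(c, r) \<in> K \<longleftrightarrow> 0 \<le> r \<and> cball c r \<subseteq> T" for c r
  proof (cases "0 \<le> r")
    case True
    have "(*\<^sub>R) r ` cball (0 :: real ^ 'n) 1 = cball 0 r"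
    proof (cases "r = 0")
      case False
      then show ?thesis using True cball_scale[of r "0 :: real ^ 'n" 1] by simp
    next
      case True
      have "(0 :: real ^ 'n) \<in> cball 0 1" by simp
      then have "(*\<^sub>R) 0 ` cball (0 :: real ^ 'n) 1 = {0}"
        using image_constant[of "0 :: real ^ 'n" "cball 0 1" "0 :: real ^ 'n"] by simp
      then show ?thesis by (simp add: True)
    qed
    with cball_translation[of c 0 r] have "cball c r = (+) c ` ((*\<^sub>R) r ` cball 0 1)"
      by simp
    then have eq: "cball c r = (\<lambda>v. c + r *\<^sub>R v) ` cball 0 1"
      by (simp only: image_image)
    have "cball c r \<subseteq> T \<longleftrightarrow> (\<forall>v\<in>cball 0 1. c + r *\<^sub>R v \<in> T)"
      unfolding eq by blast
    then show ?thesis using True by (auto simp: K_def)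
  qed (simp add: K_def)
  have "closed K"
  proof -
    have "closed ((\<lambda>p. fst p + snd p *\<^sub>R v) -` T)" for v :: "real ^ 'n"
      using closed_vimage[OF compact_imp_closed[OF T(1)],
          of "\<lambda>p. fst p + snd p *\<^sub>R v"]
      by (simp add: continuous_on_add continuous_on_fst continuous_on_snd
          continuous_on_scaleR continuous_on_id)
    moreover have "closed {p :: (real ^ 'n) \<times> real. 0 \<le> snd p}"
      by (rule closed_Collect_le) (rule continuous_on_const continuous_on_snd continuous_on_id)+
    ultimately show ?thesis
      unfolding K_def by blast
  qed
  moreover have "bounded K"
  proof -
    have "p \<in> T \<times> {0..diameter T}" if p: "p \<in> K" for p
    proof -
      obtain c r where cr: "p = (c, r)" by (cases p)
      with p have r: "0 \<le> r" and cb: "cball c r \<subseteq> T"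
        by (simp_all add: K_iff)
      have "diameter (cball c r) \<le> diameter T"
        by (rule diameter_subset[OF cb compact_imp_bounded[OF T(1)]])
      then have "r \<le> diameter T"
        using r by simp
      moreover have "c \<in> T"
        using cb r by auto
      ultimately show ?thesis
        using r by (simp add: cr)
    qed
    then have "K \<subseteq> T \<times> {0..diameter T}" by blast
    then show ?thesis
      by (rule bounded_subset[rotated])
        (intro bounded_Times compact_imp_bounded T bounded_closed_interval)
  qed
  ultimately have "compact K"
    by (simp add: compact_eq_bounded_closed)
  moreover have "K \<noteq> {}"
    using T(2) K_iff[of _ 0] by auto
  ultimately obtain p where p: "p \<in> K" "\<forall>p'\<in>K. snd p' \<le> snd p"
    using continuous_attains_sup[of K snd] continuous_on_snd[OF continuous_on_id] by blast
  obtain c r where cr: "p = (c, r)" by (cases p)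
  have "is_largest_ball (cball c r) T"
    unfolding is_largest_ball_def
  proof (intro exI conjI allI impI)
    show "0 \<le> r" "cball c r \<subseteq> T" using p(1) by (simp_all add: cr K_iff)
    fix c' r' assume sub: "cball c' r' \<subseteq> T"
    show "r' \<le> r"
    proof (cases "0 \<le> r'")
      case True
      then have "(c', r') \<in> K" using sub by (simp add: K_iff)
      then show ?thesis using p(2) by (force simp: cr)
    next
      case False
      with \<open>0 \<le> r\<close> show ?thesis by linarith
    qed
  qed simp
  then show ?thesis ..
qed

text \<open>
  By the bound on the shape ratio, the largest ball in \<open>T\<close> has diameter at least \<open>\<rho> * diameter T\<close>.
\<close>

lemma diameter_power_le_volume:
  fixes T :: "(real ^ 'n) set"
  assumes T: "int CARD('n) simplex T" and \<rho>: "0 < \<rho>" "\<rho> \<le> shape_ratio T"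
  shows "unit_ball_vol CARD('n) * (\<rho> * diameter T / 2) ^ CARD('n) \<le> measure lebesgue T"
proof -
  have comp: "compact T" using T by (rule compact_simplex)
  have ne: "T \<noteq> {}" using T by auto
  define S where "S = (SOME S. is_largest_ball S T)"
  have "is_largest_ball S T"
    unfolding S_def using someI_ex[OF largest_ball_exists[OF comp ne]] .
  then obtain c r where r: "0 \<le> r" and S: "S = cball c r" and sub: "cball c r \<subseteq> T"
    unfolding is_largest_ball_def by blast
  have d: "0 \<le> diameter T"
    using diameter_ge_0[OF compact_imp_bounded[OF comp]] .
  have "shape_ratio T = 2 * r / diameter T"
    using r by (simp add: shape_ratio_def S_def[symmetric] S)
  \<comment> \<open>For diameter zero the quotient in the shape ratio is zero by convention, and the bound is trivial.\<close>
  then have "\<rho> * diameter T \<le> 2 * r"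
    using \<rho> d r mult_right_mono[OF \<rho>(2) d] by (cases "diameter T = 0") auto
  then have "(\<rho> * diameter T / 2) ^ CARD('n) \<le> r ^ CARD('n)"
    using \<rho>(1) d by (intro power_mono) auto
  then have "unit_ball_vol CARD('n) * (\<rho> * diameter T / 2) ^ CARD('n)
      \<le> unit_ball_vol CARD('n) * r ^ CARD('n)"
    by (intro mult_left_mono) auto
  also have "\<dots> = measure lebesgue (cball c r)"
    using content_cball[OF r, of c] by (simp add: measure_completion)
  also have "\<dots> \<le> measure lebesgue T"
    using sub comp by (intro measure_mono_fmeasurable) (auto intro: lmeasurable_compact)
  finally show ?thesis .
qed

text \<open>
  Each step discards the selected element and adds finitely many elements that are smaller by the factor
  \<open>q\<close>. Measure the size of an element by \<open>level\<close>, its volume relative to \<open>\<epsilon>\<close> on the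
  logarithmic scale with base \<open>1 / q\<close>. The multiset of the levels of all elements of volume at
  least \<open>\<epsilon>\<close> never increases, and it decreases strictly whenever such an element is selected;
  well-foundedness of the multiset order allows this only finitely often. The elements added in one step
  are bounded individually but not in total, so the sum of the volumes need not decrease.
\<close>

lemma selected_volume_tendsto_zero:
  fixes vol :: "'a \<Rightarrow> real" and \<T> :: "nat \<Rightarrow> 'a set" and s :: "nat \<Rightarrow> 'a"
  assumes q: "0 < q" "q < 1" and fin: "\<And>k. finite (\<T> k)"
    and vol: "\<And>T. 0 \<le> vol T"
    and sel: "\<And>k. s k \<in> \<T> k"
    and step: "\<And>k. \<T> (Suc k) \<subseteq> (\<T> k - {s k}) \<union> N k"
    and new: "\<And>k T. T \<in> N k \<Longrightarrow> vol T \<le> q * vol (s k)"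
  shows "(\<lambda>k. vol (s k)) \<longlonglongrightarrow> 0"
proof (rule LIMSEQ_I)
  fix \<epsilon> :: real assume \<epsilon>: "0 < \<epsilon>"
  define level where "level T = nat \<lfloor>log (1 / q) (vol T / \<epsilon>)\<rfloor>" for T
  define L where "L k = {T \<in> \<T> k. \<epsilon> \<le> vol T}" for k
  define M where "M k = image_mset level (mset_set (L k))" for k
  have finL: "finite (L k)" for k
    by (simp add: L_def fin)
  have level_less: "level T < level T'" if "\<epsilon> \<le> vol T" "vol T \<le> q * vol T'" for T T'
  proof -
    have pos: "0 < vol T" using that(1) \<epsilon> by linarith
    with that(2) have "0 < q * vol T'" by linarith
    with q(1) have pos': "0 < vol T'" by (rule zero_less_mult_pos[rotated])
    have b: "1 < 1 / q" using q by simp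
    have "0 \<le> log (1 / q) (vol T / \<epsilon>)"
      using b that \<epsilon> pos by simp
    moreover have "log (1 / q) (vol T / \<epsilon>) + 1 \<le> log (1 / q) (vol T' / \<epsilon>)"
    proof -
      have "log (1 / q) (vol T / \<epsilon>) + 1 = log (1 / q) (vol T / \<epsilon> * (1 / q))"
        using b pos \<epsilon> q by (subst log_mult) auto
      also have "\<dots> \<le> log (1 / q) (vol T' / \<epsilon>)"
        using b pos pos' \<epsilon> q that by (subst log_le_cancel_iff) (auto simp: field_simps)
      finally show ?thesis .
    qed
    ultimately show ?thesis
      unfolding level_def by linarith
  qed
  have le: "M (Suc k) \<le> M k \<and> (\<epsilon> \<le> vol (s k) \<longrightarrow> M (Suc k) < M k)" for k
  proof (cases "\<epsilon> \<le> vol (s k)")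
    case True
    \<comment> \<open>\<open>?I\<close> survives the step; \<open>?K\<close> is new, and it is dominated by \<open>s k\<close>, a member of the discarded part \<open>?J\<close>.\<close>
    let ?I = "L (Suc k) \<inter> (L k - {s k})"
    let ?K = "L (Suc k) - (L k - {s k})"
    let ?J = "L k - L (Suc k) \<union> {s k}"
    have "level T < level (s k)" if "T \<in> ?K" for T
      using that step[of k] new[of T k] by (intro level_less) (auto simp: L_def)
    then have "multp (<) (image_mset level (mset_set ?I) + image_mset level (mset_set ?K))
       (image_mset level (mset_set ?I) + image_mset level (mset_set ?J))"
      by (intro one_step_implies_multp) (auto simp: finL mset_set_empty_iff)
    moreover have "M (Suc k) = image_mset level (mset_set ?I) + image_mset level (mset_set ?K)"
    proof -
      have "L (Suc k) = ?I \<union> ?K" by blast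
      then show ?thesis
        unfolding M_def image_mset_union[symmetric]
        by (subst mset_set_Union[symmetric]) (auto simp: finL)
    qed
    moreover have "M k = image_mset level (mset_set ?I) + image_mset level (mset_set ?J)"
    proof -
      have "L k = ?I \<union> ?J" using True sel[of k] by (auto simp: L_def)
      then show ?thesis
        unfolding M_def image_mset_union[symmetric]
        by (subst mset_set_Union[symmetric]) (auto simp: finL)
    qed
    ultimately have "M (Suc k) < M k"
      by (simp add: less_multiset_def)
    then show ?thesis by simp
  next
    case False
    have "vol T < \<epsilon>" if "T \<in> N k" for T
    proof -
      have "q * vol (s k) \<le> vol (s k)"
        using q vol[of "s k"] by (simp add: mult_left_le_one_le)
      with new[OF that] False show ?thesis by linarith
    qed
    then have "L (Suc k) \<subseteq> L k"
      using step[of k] by (force simp: L_def)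
    then have "M (Suc k) \<subseteq># M k"
      unfolding M_def by (intro image_mset_subseteq_mono) (simp add: finL)
    then show ?thesis
      using False by (simp add: subset_eq_imp_le_multiset)
  qed
  have anti: "M j \<le> M i" if "i \<le> j" for i j
    using that by (rule lift_Suc_antimono_le[of M, rotated]) (use le in blast)
  \<comment> \<open>From an index with minimal multiset on, no strict decrease occurs.\<close>
  obtain k0 where k0: "\<And>k. \<not> M k < M k0"
    using wf_less_multiset[unfolded wf_eq_minimal, rule_format, of "M 0" "range M"] by auto
  have "vol (s k) < \<epsilon>" if "k0 \<le> k" for k
    using le[of k] anti[OF that] k0[of "Suc k"] by (meson not_le order_less_le_trans)
  then show "\<exists>no. \<forall>n\<ge>no. norm (vol (s n) - 0) < \<epsilon>"
    using vol by (intro exI[of _ k0]) simp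
qed

section \<open>Runs of the penalty algorithm\<close>

lemma subdivision_refine:
  assumes "subdivision Q \<T>" "T0 \<in> \<T>" "refinement_step q \<rho> \<T> T0 \<T>'"
  shows "subdivision Q \<T>'"
proof -
  obtain R where R: "subdivision T0 R" "\<T>' = (\<T> - {T0}) \<union> R"
    using assms(3) unfolding refinement_step_def by blast
  have "\<Union>\<T>' = \<Union>(\<T> - {T0}) \<union> T0"
    using R unfolding subdivision_def by auto
  also have "\<dots> = Q"
    using assms(1,2) unfolding subdivision_def by blast
  finally show ?thesis
    using assms(1) R unfolding subdivision_def by auto
qed

lemma reached_Suc_iff:
  "reached f Uad A B x (Suc k) \<longleftrightarrow>
    k = 0 \<or> reached f Uad A B x k \<and> \<not> stop_test f Uad A B (x k)"
  unfolding reached_def by (auto simp: less_Suc_eq)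

context
  fixes Q :: "(real ^ 'n) set"
    and Uad :: "'u::real_normed_vector set"
    and A :: "'y::real_normed_vector \<Rightarrow>\<^sub>L 'z::real_normed_vector"
    and B :: "'u \<Rightarrow>\<^sub>L 'z"
    and F f :: "(real ^ 'n) \<times> 'y \<times> 'u \<Rightarrow> real"
    and q \<rho> :: real and P :: "real \<Rightarrow> real"
    and \<T> :: "nat \<Rightarrow> (real ^ 'n) set set"
    and \<gamma> :: "nat \<Rightarrow> (real ^ 'n) set \<Rightarrow> real"
    and w :: "nat \<Rightarrow> (real ^ 'n) set \<Rightarrow> (real ^ 'n) \<times> 'y \<times> 'u"
    and Tbar :: "nat \<Rightarrow> (real ^ 'n) set"
    and x :: "nat \<Rightarrow> (real ^ 'n) \<times> 'y \<times> 'u"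
  assumes run: "penalty_algorithm_run Q F f Uad A B P q \<rho> \<T> \<gamma> w Tbar"
    and x: "\<And>k. x k = w k (Tbar k)"
begin

lemma run_step:
  assumes "reached f Uad A B x k"
  shows "T \<in> \<T> k \<Longrightarrow> 0 < \<gamma> k T"
    and "T \<in> \<T> k \<Longrightarrow> is_arg_min (penalty_objective F f Uad A B P (\<gamma> k T) T)
      (penalty_feasible Uad A B T) (w k T)"
    and "Tbar k \<in> \<T> k"
    and "T \<in> \<T> k \<Longrightarrow> penalty_objective F f Uad A B P (\<gamma> k (Tbar k)) (Tbar k) (x k)
      \<le> penalty_objective F f Uad A B P (\<gamma> k T) T (w k T)"
    and "\<not> stop_test f Uad A B (x k) \<Longrightarrow> refinement_step q \<rho> (\<T> k) (Tbar k) (\<T> (Suc k))"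
proof -
  have "x = (\<lambda>j. w j (Tbar j))" using x by blast
  then have r: "reached f Uad A B (\<lambda>j. w j (Tbar j)) k" using assms by simp
  note * = run[unfolded penalty_algorithm_run_def, THEN conjunct2, THEN conjunct2, THEN conjunct2,
    THEN conjunct2, THEN conjunct2, THEN conjunct2, THEN conjunct2, THEN conjunct2,
    rule_format, OF r]
  show "T \<in> \<T> k \<Longrightarrow> 0 < \<gamma> k T" using * by blast
  show "T \<in> \<T> k \<Longrightarrow> is_arg_min (penalty_objective F f Uad A B P (\<gamma> k T) T)
      (penalty_feasible Uad A B T) (w k T)" using * by blast
  show "Tbar k \<in> \<T> k" using * by (simp add: is_arg_min_def)
  show "T \<in> \<T> k \<Longrightarrow> penalty_objective F f Uad A B P (\<gamma> k (Tbar k)) (Tbar k) (x k)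
      \<le> penalty_objective F f Uad A B P (\<gamma> k T) T (w k T)"
    using * by (simp add: is_arg_min_linorder x)
  show "\<not> stop_test f Uad A B (x k) \<Longrightarrow> refinement_step q \<rho> (\<T> k) (Tbar k) (\<T> (Suc k))"
    using * by (simp add: x)
qed

lemma run_subdivision:
  assumes "reached f Uad A B x k"
  shows "subdivision Q (\<T> k) \<and> (\<forall>T\<in>\<T> k. \<rho> \<le> shape_ratio T)"
  using assms
proof (induction k)
  case 0
  then show ?case by (simp add: reached_def)
next
  case (Suc k)
  show ?case
  proof (cases "k = 0")
    case True
    then show ?thesis using run unfolding penalty_algorithm_run_def by simp
  next
    case False
    with Suc.prems have r: "reached f Uad A B x k" "\<not> stop_test f Uad A B (x k)"
      by (simp_all add: reached_Suc_iff)
    note IH = Suc.IH[OF r(1)] and step = run_step(5)[OF r]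
    have "\<rho> \<le> shape_ratio T" if "T \<in> \<T> (Suc k)" for T
      using that IH step unfolding refinement_step_def by blast
    then show ?thesis
      using subdivision_refine[OF _ run_step(3)[OF r(1)] step] IH by blast
  qed
qed

text \<open>
  Every refinement puts only simplices of shape ratio at least \<open>\<rho>\<close> and of volume at most \<open>q\<close> times that of the
  selected simplex into the subdivision. So the selected volumes tend to zero, and with them the
  diameters.
\<close>

lemma run_diameter_tendsto_zero:
  assumes nonstop: "\<And>k. 1 \<le> k \<Longrightarrow> \<not> stop_test f Uad A B (x k)"
  shows "(\<lambda>k. diameter (Tbar (Suc k))) \<longlonglongrightarrow> 0"
proof -
  have r: "reached f Uad A B x (Suc k)" for k
    using nonstop by (simp add: reached_def)
  note sub = run_subdivision[OF r] and sel = run_step(3)[OF r]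
    and step = run_step(5)[OF r nonstop]
  have q: "0 < q" "q < 1" and \<rho>: "0 < \<rho>"
    using run unfolding penalty_algorithm_run_def by blast+
  have simplex: "int CARD('n) simplex Tbar (Suc k)" for k
    using sub[of k] sel[of k] unfolding subdivision_def by blast
  have vol: "(\<lambda>k. measure lebesgue (Tbar (Suc k))) \<longlonglongrightarrow> 0"
  proof (rule selected_volume_tendsto_zero[OF q, of "\<lambda>k. \<T> (Suc k)" _ _
        "\<lambda>k. \<T> (Suc (Suc k)) - \<T> (Suc k)"])
    fix k
    show "finite (\<T> (Suc k))"
      using sub[of k] unfolding subdivision_def by blast
    show "Tbar (Suc k) \<in> \<T> (Suc k)" by (rule sel)
    show "\<T> (Suc (Suc k)) \<subseteq> \<T> (Suc k) - {Tbar (Suc k)} \<union> (\<T> (Suc (Suc k)) - \<T> (Suc k))"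
      using step[of k] unfolding refinement_step_def by auto
    show "measure lebesgue T \<le> q * measure lebesgue (Tbar (Suc k))"
      if "T \<in> \<T> (Suc (Suc k)) - \<T> (Suc k)" for T
      using step[of k] that unfolding refinement_step_def by auto
  qed simp
  define c where "c = unit_ball_vol CARD('n)"
  have c: "0 < c" by (simp add: c_def)
  have d: "0 \<le> diameter (Tbar (Suc k))" for k
    using diameter_ge_0[OF compact_imp_bounded[OF compact_simplex[OF simplex]]] .
  have "c * (\<rho> * diameter (Tbar (Suc k)) / 2) ^ CARD('n) \<le> measure lebesgue (Tbar (Suc k))" for k
    unfolding c_def using diameter_power_le_volume[OF simplex \<rho>] sub[of k] sel[of k] by blast
  then have bound: "norm ((\<rho> * diameter (Tbar (Suc k)) / 2) ^ CARD('n)) \<le> measure lebesgue (Tbar (Suc k)) / c" for k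
    using c \<rho> d[of k] by (simp add: pos_le_divide_eq mult.commute)
  have "(\<lambda>k. measure lebesgue (Tbar (Suc k)) / c) \<longlonglongrightarrow> 0"
    by (rule tendsto_divide_zero[OF vol])
  then have "(\<lambda>k. (\<rho> * diameter (Tbar (Suc k)) / 2) ^ CARD('n)) \<longlonglongrightarrow> 0"
    by (rule Lim_null_comparison[OF always_eventually[OF allI[OF bound]]])
  then have "(\<lambda>k. \<rho> * diameter (Tbar (Suc k)) / 2) \<longlonglongrightarrow> 0"
    by simp
  then have "(\<lambda>k. 2 / \<rho> * (\<rho> * diameter (Tbar (Suc k)) / 2)) \<longlonglongrightarrow> 0"
    by (rule tendsto_mult_right_zero)
  then show ?thesis using \<rho> by simp
qed

text \<open>
  Any simplex of the subdivision that contains the parameter of \<open>z\<close> admits \<open>z\<close> at zero penalty, since the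
  interpolant lies above \<open>phi\<close>. The selected iterate has the least penalty value over all simplices.
\<close>

lemma penalty_value_le_feasible_value:
  assumes r: "reached f Uad A B x k" and convex: "convex_on Q (phi f Uad A B)"
    and P: "\<And>s. s \<le> 0 \<Longrightarrow> P s = 0" and z: "ovr_feasible Q f Uad A B z"
  shows "penalty_objective F f Uad A B P (\<gamma> k (Tbar k)) (Tbar k) (x k) \<le> F z"
proof -
  obtain \<beta> y u where z_eq: "z = (\<beta>, y, u)" by (cases z)
  have feas: "\<beta> \<in> Q" "f z \<le> phi f Uad A B \<beta>" "A y - B u = 0" "u \<in> Uad"
    using z by (simp_all add: z_eq ovr_feasible_def)
  have sub: "subdivision Q (\<T> k)"
    using run_subdivision[OF r] by blast
  then obtain T where T: "T \<in> \<T> k" "\<beta> \<in> T"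
    using feas(1) unfolding subdivision_def by blast
  have "int CARD('n) simplex T" "T \<subseteq> Q"
    using sub T unfolding subdivision_def by auto
  then have "phi f Uad A B \<beta> \<le> affine_interp (phi f Uad A B) T \<beta>"
    using convex_le_affine_interp[OF _ convex_on_subset[OF convex] T(2)]
      convex_simplex by blast
  with feas(2) have "P (f z - affine_interp (phi f Uad A B) T \<beta>) = 0"
    by (intro P) simp
  then have "penalty_objective F f Uad A B P (\<gamma> k T) T z = F z"
    by (simp add: penalty_objective_def z_eq)
  moreover have "penalty_feasible Uad A B T z"
    using feas T(2) by (simp add: penalty_feasible_def z_eq)
  then have "penalty_objective F f Uad A B P (\<gamma> k T) T (w k T)
      \<le> penalty_objective F f Uad A B P (\<gamma> k T) T z"
    using run_step(2)[OF r T(1)] unfolding is_arg_min_linorder by blast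
  ultimately show ?thesis
    using run_step(4)[OF r T(1)] by linarith
qed

end

section \<open>Convergence of the penalty algorithm\<close>

text \<open>
  Once \<open>\<gamma> k\<close> exceeds \<open>C / P \<epsilon>\<close>, a violation of at least \<open>\<epsilon>\<close> would cost more than \<open>C\<close>.
\<close>

lemma penalty_forces_feasibility:
  fixes P :: "real \<Rightarrow> real" and s :: "nat \<Rightarrow> real"
  assumes P: "mono P" "\<And>s. 0 < s \<Longrightarrow> 0 < P s"
    and \<gamma>: "filterlim \<gamma> at_top sequentially"
    and bound: "\<And>k. \<gamma> k * P (s k) \<le> C" and \<epsilon>: "0 < \<epsilon>"
  shows "\<forall>\<^sub>F k in sequentially. s k < \<epsilon>"
proof -
  have "\<forall>\<^sub>F k in sequentially. max 1 (C / P \<epsilon> + 1) \<le> \<gamma> k"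
    using \<gamma> unfolding filterlim_at_top by blast
  then show ?thesis
  proof eventually_elim
    case (elim k)
    show ?case
    proof (rule ccontr)
      assume "\<not> s k < \<epsilon>"
      then have "P \<epsilon> \<le> P (s k)"
        using P(1) by (simp add: monoD)
      then have "\<gamma> k * P \<epsilon> \<le> \<gamma> k * P (s k)"
        using elim by (intro mult_left_mono) auto
      then have "\<gamma> k * P \<epsilon> \<le> C"
        using bound[of k] by linarith
      then have "\<gamma> k \<le> C / P \<epsilon>"
        using P(2)[OF \<epsilon>] by (simp add: pos_le_divide_eq)
      with elim show False by linarith
    qed
  qed
qed

text \<open>
  Otherwise the infinitely many terms at a fixed positive distance from \<open>z\<close> would form a
  subsequence without the required cluster point.
\<close>

lemma tendsto_if_subsequences_cluster:
  fixes X :: "nat \<Rightarrow> 'a::metric_space"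
  assumes "\<And>s :: nat \<Rightarrow> nat. strict_mono s \<Longrightarrow> \<exists>r :: nat \<Rightarrow> nat. strict_mono r \<and> (X \<circ> s \<circ> r) \<longlonglongrightarrow> z"
  shows "X \<longlonglongrightarrow> z"
proof (rule ccontr)
  assume "\<not> X \<longlonglongrightarrow> z"
  then obtain e where e: "0 < e" and "\<forall>N. \<exists>n\<ge>N. e \<le> dist (X n) z"
    unfolding lim_sequentially by (auto simp: not_less)
  then have inf: "infinite {n. e \<le> dist (X n) z}"
    unfolding infinite_nat_iff_unbounded_le by blast
  define s where "s = enumerate {n. e \<le> dist (X n) z}"
  have s: "strict_mono s"
    unfolding s_def using strict_mono_enumerate[OF inf] .
  have far: "e \<le> dist (X (s n)) z" for n
    using enumerate_in_set[OF inf, of n] by (simp add: s_def)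
  obtain r where "(X \<circ> s \<circ> r) \<longlonglongrightarrow> z"
    using assms[OF s] by blast
  then obtain n where "dist ((X \<circ> s \<circ> r) n) z < e"
    using e unfolding lim_sequentially by blast
  with far[of "r n"] show False by simp
qed

lemma has_C1_derivative_on_imp_continuous_on:
  "has_C1_derivative_on g g' X \<Longrightarrow> continuous_on X g"
  unfolding has_C1_derivative_on_def
  using has_derivative_continuous_on[of X g "\<lambda>x. blinfun_apply (g' x)"] by blast

theorem theorem4p2:
  fixes Q :: "(real ^ 'n) set"
    and Uad :: "'u::{real_inner, complete_space} set"
    and A :: "'y::{real_inner, complete_space} \<Rightarrow>\<^sub>L ('y \<Rightarrow>\<^sub>L real)"
    and B :: "'u \<Rightarrow>\<^sub>L ('y \<Rightarrow>\<^sub>L real)"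
    and F f :: "(real ^ 'n) \<times> 'y \<times> 'u \<Rightarrow> real"
    and f' :: "(real ^ 'n) \<times> 'y \<times> 'u \<Rightarrow> ((real ^ 'n) \<times> 'y \<times> 'u) \<Rightarrow>\<^sub>L real"
    and \<mu> q \<rho> :: real
    and P :: "real \<Rightarrow> real"
    and \<T> :: "nat \<Rightarrow> (real ^ 'n) set set"
    and \<gamma> :: "nat \<Rightarrow> (real ^ 'n) set \<Rightarrow> real"
    and w :: "nat \<Rightarrow> (real ^ 'n) set \<Rightarrow> (real ^ 'n) \<times> 'y \<times> 'u"
    and Tbar :: "nat \<Rightarrow> (real ^ 'n) set"
    and x :: "nat \<Rightarrow> (real ^ 'n) \<times> 'y \<times> 'u"
  assumes Q: "polyhedron Q" "bounded Q" "Q \<noteq> {}" "interior Q \<noteq> {}"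
    and Uad: "Uad \<noteq> {}" "closed Uad" "convex Uad"
    and A: "isomorphism_blinfun A"
    and F_bdd: "bdd_below (F ` (Q \<times> UNIV \<times> UNIV))"
    and F_convex: "convex_on (Q \<times> UNIV \<times> UNIV) F"
    and F_C1: "\<exists>F'. has_C1_derivative_on F F' (Q \<times> UNIV \<times> UNIV)"
    and f_bdd: "bdd_below (f ` (Q \<times> UNIV \<times> UNIV))"
    and f_convex: "convex_on (Q \<times> UNIV \<times> UNIV) f"
    and f_C1: "has_C1_derivative_on f f' (Q \<times> UNIV \<times> UNIV)"
    and lipschitz: "\<forall>M\<ge>0. \<exists>L\<ge>0. \<forall>\<beta>\<in>Q. \<forall>\<beta>1\<in>Q. \<forall>\<beta>2\<in>Q. \<forall>y1 y2. \<forall>u\<in>Uad. \<forall>u1\<in>Uad. \<forall>u2\<in>Uad.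
        norm y1 \<le> M \<and> norm y2 \<le> M \<and> norm u \<le> M \<and> norm u1 \<le> M \<and> norm u2 \<le> M \<longrightarrow>
        norm (partial_beta (f' (\<beta>1, y1, u1)) - partial_beta (f' (\<beta>2, y2, u2)))
          \<le> L * (norm (\<beta>1 - \<beta>2) + norm (y1 - y2) + norm (u1 - u2)) \<and>
        \<bar>F (\<beta>, y1, u1) - F (\<beta>, y2, u2)\<bar> \<le> L * (norm (y1 - y2) + norm (u1 - u2)) \<and>
        norm (partial_u (f' (\<beta>1, sol_op A B u, u)) - partial_u (f' (\<beta>2, sol_op A B u, u)))
          \<le> L * norm (\<beta>1 - \<beta>2) \<and>
        norm (partial_y (f' (\<beta>1, sol_op A B u, u)) - partial_y (f' (\<beta>2, sol_op A B u, u)))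
          \<le> L * norm (\<beta>1 - \<beta>2)"
    and mu: "\<mu> > 0"
    and strongly_convex: "\<forall>\<beta>\<in>Q. \<forall>u1\<in>Uad. \<forall>u2\<in>Uad.
        f (\<beta>, sol_op A B u2, u2) \<ge> f (\<beta>, sol_op A B u1, u1)
          + blinfun_apply (partial_y (f' (\<beta>, sol_op A B u1, u1))) (sol_op A B (u2 - u1))
          + blinfun_apply (partial_u (f' (\<beta>, sol_op A B u1, u1))) (u2 - u1)
          + \<mu> / 2 * (norm (u2 - u1))\<^sup>2"
    and P: "mono P" "convex_on UNIV P" "\<forall>s\<le>0. P s = 0" "\<forall>s>0. P s > 0"
    and run: "penalty_algorithm_run Q F f Uad A B P q \<rho> \<T> \<gamma> w Tbar"
    and x: "\<forall>k. x k = w k (Tbar k)"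
    and gamma: "(\<forall>k\<ge>1. \<not> stop_test f Uad A B (x k)) \<longrightarrow>
        filterlim (\<lambda>k. \<gamma> k (Tbar k)) at_top sequentially"
  shows "((\<exists>k. reached f Uad A B x k \<and> stop_test f Uad A B (x k) \<and>
            ovr_global_solution Q F f Uad A B (x k))
      \<or> ((\<forall>k\<ge>1. \<not> stop_test f Uad A B (x k)) \<and>
         (\<exists>r z. strict_mono (r :: nat \<Rightarrow> nat) \<and> (\<forall>j. 1 \<le> r j) \<and>
            ovr_global_solution Q F f Uad A B z \<and> (\<lambda>j. x (r j)) \<longlonglongrightarrow> z)))
    \<and> (\<forall>z. ovr_global_solution Q F f Uad A B z \<and>
            (\<forall>z'. ovr_global_solution Q F f Uad A B z' \<longrightarrow> z' = z) \<and>
            (\<forall>k\<ge>1. \<not> stop_test f Uad A B (x k)) \<longrightarrow> x \<longlonglongrightarrow> z)"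
proof -
  define \<phi> where "\<phi> = phi f Uad A B"
  define feas where "feas = ovr_feasible Q f Uad A B"
  define glob where "glob = ovr_global_solution Q F f Uad A B"
  have glob_iff: "glob z \<longleftrightarrow> feas z \<and> (\<forall>z'. feas z' \<longrightarrow> F z \<le> F z')" for z
    unfolding glob_def feas_def ovr_global_solution_def is_arg_min_linorder by blast
  have compact_Q: "compact Q"
    using Q(1,2) polyhedron_imp_closed by (simp add: compact_eq_bounded_closed)
  have xw: "\<And>k. x k = w k (Tbar k)" using x by blast
  have P0: "\<And>s. s \<le> 0 \<Longrightarrow> P s = 0" and Ppos: "\<And>s. 0 < s \<Longrightarrow> 0 < P s"
    using P(3,4) by blast+
  have P_nonneg: "0 \<le> P s" for s
    using P0[of s] Ppos[of s] by (cases "s \<le> 0") auto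

  obtain A' where A': "A' o\<^sub>L A = id_blinfun" "A o\<^sub>L A' = id_blinfun"
    using A unfolding isomorphism_blinfun_def by blast
  have A'A: "A' (A y) = y" for y
    using arg_cong[OF A'(1), of "\<lambda>g. blinfun_apply g y"] by simp
  have AA': "A (A' v) = v" for v
    using arg_cong[OF A'(2), of "\<lambda>g. blinfun_apply g v"] by simp
  define S where "S = A' o\<^sub>L B"
  have state: "A y = B u \<longleftrightarrow> y = S u" for y u
    unfolding S_def using A'A AA' by (metis blinfun_apply_blinfun_compose)
  have "inv (blinfun_apply A) = blinfun_apply A'"
    using A'A AA' by (intro inv_unique_comp) (simp_all add: fun_eq_iff)
  then have sol_op: "sol_op A B u = S u" for u
    by (simp add: sol_op_def S_def)

  \<comment> \<open>The embedding of the control direction \<open>h\<close> into the product space, along the graph of \<open>S\<close>.\<close>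
  define J where "J = Blinfun (\<lambda>h. (0 :: real ^ 'n, S h, h))"
  have J: "J h = (0, S h, h)" for h
    unfolding J_def by (subst bounded_linear_Blinfun_apply)
      (auto intro!: bounded_linear_Pair bounded_linear_zero bounded_linear_ident blinfun.bounded_linear_right)
  define G where "G \<beta> u = f (\<beta>, S u, u)" for \<beta> u
  define D where "D \<beta> u = f' (\<beta>, S u, u) o\<^sub>L J" for \<beta> u
  have D: "D \<beta> u h = partial_y (f' (\<beta>, S u, u)) (S h) + partial_u (f' (\<beta>, S u, u)) h" for \<beta> u h
    using blinfun.add_right[of "f' (\<beta>, S u, u)" "(0, S h, 0)" "(0, 0, h)"]
    by (simp add: D_def J)
  define embed where "embed = (\<lambda>(\<beta> :: real ^ 'n, u). (\<beta>, S u, u))"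
  have embed_cont: "continuous_on (Q \<times> Uad) embed"
    unfolding embed_def split_beta by (intro continuous_intros)
  have embed_in: "embed ` (Q \<times> Uad) \<subseteq> Q \<times> UNIV \<times> UNIV"
    by (auto simp: embed_def)
  have f_cont: "continuous_on (Q \<times> UNIV \<times> UNIV) f"
    using f_C1 by (rule has_C1_derivative_on_imp_continuous_on)
  have F_cont: "continuous_on (Q \<times> UNIV \<times> UNIV) F"
    using F_C1 has_C1_derivative_on_imp_continuous_on by blast
  have f'_cont: "continuous_on (Q \<times> UNIV \<times> UNIV) f'"
    using f_C1 unfolding has_C1_derivative_on_def by blast
  obtain mf where mf: "\<And>z. z \<in> Q \<times> UNIV \<times> UNIV \<Longrightarrow> mf \<le> f z"
    using f_bdd unfolding bdd_below_def by blast
  obtain mF where mF: "\<And>z. z \<in> Q \<times> UNIV \<times> UNIV \<Longrightarrow> mF \<le> F z"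
    using F_bdd unfolding bdd_below_def by blast

  interpret V: strongly_convex_family Q Uad G D \<mu>
  proof
    show "Uad \<noteq> {}" "closed Uad" "convex Uad" "0 < \<mu>" by fact+
    show "bdd_below (G \<beta> ` Uad)" if "\<beta> \<in> Q" for \<beta>
      using mf that by (intro bdd_belowI[of _ mf]) (auto simp: G_def)
    show "continuous_on (Q \<times> Uad) (\<lambda>(\<beta>, u). G \<beta> u)"
      using continuous_on_compose2[OF f_cont embed_cont embed_in]
      by (simp add: G_def embed_def split_beta)
    have "continuous_on (Q \<times> Uad) (\<lambda>p. f' (embed p) o\<^sub>L J)"
      by (intro bounded_bilinear.continuous_on[OF bounded_bilinear_blinfun_compose]
          continuous_on_const continuous_on_compose2[OF f'_cont embed_cont embed_in])
    then show "continuous_on (Q \<times> Uad) (\<lambda>(\<beta>, u). D \<beta> u)"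
      by (simp add: D_def embed_def split_beta)
    show "G \<beta> u + D \<beta> u (v - u) + \<mu> / 2 * (norm (v - u))\<^sup>2 \<le> G \<beta> v"
      if "\<beta> \<in> Q" "u \<in> Uad" "v \<in> Uad" for \<beta> u v
      using strongly_convex[rule_format, OF that] unfolding sol_op G_def D by simp
  qed

  have \<phi>: "\<phi> = V.val"
  proof
    fix \<beta>
    have "{f (\<beta>, y, u) | y u. u \<in> Uad \<and> A y = B u} = G \<beta> ` Uad"
      unfolding state G_def by blast
    then show "\<phi> \<beta> = V.val \<beta>"
      by (simp add: \<phi>_def phi_def V.val_def)
  qed
  have "convex_on (Q \<times> Uad) (\<lambda>(\<beta>, u). G \<beta> u)"
  proof (rule convex_onI)
    show "convex (Q \<times> Uad)"
      using polyhedron_imp_convex[OF Q(1)] Uad(3) by (rule convex_Times)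
    fix t :: real and p p' assume t: "0 < t" "t < 1" and p: "p \<in> Q \<times> Uad" "p' \<in> Q \<times> Uad"
    have "embed ((1 - t) *\<^sub>R p + t *\<^sub>R p') = (1 - t) *\<^sub>R embed p + t *\<^sub>R embed p'"
      by (simp add: embed_def split_beta blinfun.add_right blinfun.scaleR_right)
    then have "f (embed ((1 - t) *\<^sub>R p + t *\<^sub>R p')) \<le> (1 - t) * f (embed p) + t * f (embed p')"
      using convex_onD[OF f_convex, of t "embed p" "embed p'"] t p embed_in by auto
    then show "(case (1 - t) *\<^sub>R p + t *\<^sub>R p' of (\<beta>, u) \<Rightarrow> G \<beta> u)
        \<le> (1 - t) * (case p of (\<beta>, u) \<Rightarrow> G \<beta> u) + t * (case p' of (\<beta>, u) \<Rightarrow> G \<beta> u)"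
      by (simp add: embed_def G_def split_beta)
  qed
  then have \<phi>_convex: "convex_on Q \<phi>"
    unfolding \<phi> by (rule V.val_convex)

  have feas_sol: "feas (\<beta>, S (V.sol \<beta>), V.sol \<beta>)" if "\<beta> \<in> Q" for \<beta>
    using that V.G_sol[OF that] V.sol_in[OF that]
    by (simp add: feas_def ovr_feasible_def \<phi>_def[symmetric] \<phi> G_def state)
  define pen where "pen k = f (x k) - affine_interp \<phi> (Tbar k) (fst (x k))" for k
  have x_le: "F (x k) + \<gamma> k (Tbar k) * P (pen k) \<le> F z"
    if r: "reached f Uad A B x k" and z: "feas z" for k z
    using penalty_value_le_feasible_value[OF run xw r \<phi>_convex[unfolded \<phi>_def] P0 z[unfolded feas_def]]
    by (simp add: penalty_objective_def split_beta pen_def \<phi>_def)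
  have iterate: "int CARD('n) simplex Tbar k" "Tbar k \<subseteq> Q" "fst (x k) \<in> Tbar k"
      "snd (snd (x k)) \<in> Uad" "fst (snd (x k)) = S (snd (snd (x k)))" "0 < \<gamma> k (Tbar k)"
    if r: "reached f Uad A B x k" for k
  proof -
    have T: "Tbar k \<in> \<T> k" and sub: "subdivision Q (\<T> k)"
      using run_step(3)[OF run xw r] run_subdivision[OF run xw r] by blast+
    show "int CARD('n) simplex Tbar k" "Tbar k \<subseteq> Q"
      using T sub unfolding subdivision_def by auto
    have "penalty_feasible Uad A B (Tbar k) (x k)"
      using run_step(2)[OF run xw r T] unfolding is_arg_min_linorder xw by blast
    then show "fst (x k) \<in> Tbar k" "snd (snd (x k)) \<in> Uad"
      "fst (snd (x k)) = S (snd (snd (x k)))"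
      by (simp_all add: penalty_feasible_def split_beta state)
    show "0 < \<gamma> k (Tbar k)"
      using run_step(1)[OF run xw r T] .
  qed
  have F_le: "F (x k) \<le> F z" if "reached f Uad A B x k" "feas z" for k z
    using x_le[OF that] mult_nonneg_nonneg[OF less_imp_le[OF iterate(6)[OF that(1)]] P_nonneg[of "pen k"]]
    by linarith

  have stop_case: "glob (x k)" if r: "reached f Uad A B x k" and stop: "stop_test f Uad A B (x k)" for k
  proof -
    obtain \<beta> y u where x_eq: "x k = (\<beta>, y, u)" by (cases "x k")
    have "feas (x k)"
      using stop iterate[OF r]
      by (auto simp: x_eq feas_def ovr_feasible_def stop_test_def state)
    then show ?thesis
      using F_le[OF r] unfolding glob_iff by blast
  qed

  \<comment> \<open>The iterates are shifted by one, since iteration numbers start at \<open>1\<close> and index \<open>0\<close> is unconstrained.\<close>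
  have cluster: "\<exists>r z. strict_mono (r :: nat \<Rightarrow> nat) \<and> glob z \<and> ((\<lambda>k. x (Suc k)) \<circ> s \<circ> r) \<longlonglongrightarrow> z"
    if nonstop: "\<forall>k\<ge>1. \<not> stop_test f Uad A B (x k)" and s: "strict_mono s" for s :: "nat \<Rightarrow> nat"
  proof -
    have reached: "reached f Uad A B x (Suc k)" for k
      using nonstop by (simp add: reached_def)
    note it = iterate[OF reached]
    define b where "b k = fst (x (Suc k))" for k
    define u where "u k = snd (snd (x (Suc k)))" for k
    have x_eq: "x (Suc k) = (b k, S (u k), u k)" for k
      using it(5)[of k] by (simp add: b_def u_def prod_eq_iff)
    have bQ: "b k \<in> Q" and uU: "u k \<in> Uad" for k
      using it(2,3,4)[of k] by (auto simp: b_def u_def)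
    have gap_nonneg: "0 \<le> G (b k) (u k) - V.val (b k)" for k
      using V.val_le[OF bQ uU] by simp
    have \<gamma>_lim: "filterlim (\<lambda>k. \<gamma> (Suc k) (Tbar (Suc k))) at_top sequentially"
      using gamma nonstop filterlim_sequentially_Suc[of "\<lambda>k. \<gamma> k (Tbar k)"] by blast
    obtain \<beta>0 where \<beta>0: "\<beta>0 \<in> Q" using Q(3) by blast
    \<comment> \<open>Comparison with an arbitrary feasible point bounds the penalty terms.\<close>
    have bound: "\<gamma> (Suc k) (Tbar (Suc k)) * P (pen (Suc k)) \<le> F (\<beta>0, S (V.sol \<beta>0), V.sol \<beta>0) - mF" for k
      using x_le[OF reached feas_sol[OF \<beta>0], of k] mF[of "x (Suc k)"] bQ[of k]
      by (simp add: x_eq)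
    \<comment> \<open>The gap is the sum of the constraint violation in the penalty term and of the interpolation error.\<close>
    have gap: "(\<lambda>k. G (b k) (u k) - V.val (b k)) \<longlonglongrightarrow> 0"
    proof (rule LIMSEQ_I)
      fix \<epsilon> :: real assume \<epsilon>: "0 < \<epsilon>"
      have "\<forall>\<^sub>F k in sequentially. pen (Suc k) < \<epsilon> / 2"
        using penalty_forces_feasibility[OF P(1) Ppos \<gamma>_lim bound, of "\<epsilon> / 2"] \<epsilon> by simp
      moreover have "\<forall>\<^sub>F k in sequentially. affine_interp \<phi> (Tbar (Suc k)) (b k) \<le> \<phi> (b k) + \<epsilon> / 2"
        using affine_interp_near[OF compact_Q V.val_continuous it(1,2) it(3)
            run_diameter_tendsto_zero[OF run xw], of "\<epsilon> / 2"] nonstop \<epsilon>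
        unfolding \<phi> b_def by simp
      ultimately have "\<forall>\<^sub>F k in sequentially. norm (G (b k) (u k) - V.val (b k) - 0) < \<epsilon>"
      proof eventually_elim
        case (elim k)
        then have "G (b k) (u k) < V.val (b k) + \<epsilon>"
          by (simp add: pen_def x_eq G_def \<phi>)
        then show ?case using gap_nonneg[of k] by simp
      qed
      then show "\<exists>no. \<forall>n\<ge>no. norm (G (b n) (u n) - V.val (b n) - 0) < \<epsilon>"
        unfolding eventually_sequentially .
    qed
    obtain l r where l: "l \<in> Q" and r: "strict_mono r" and bl: "(b \<circ> s \<circ> r) \<longlonglongrightarrow> l"
      using compact_Q[unfolded compact_def, rule_format, of "b \<circ> s"] bQ by auto
    define z where "z = (l, S (V.sol l), V.sol l)"
    have "(u \<circ> s \<circ> r) \<longlonglongrightarrow> V.sol l"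
    proof (rule V.minimizing_sequence_tendsto[of "b \<circ> s \<circ> r" _ l, OF _ _ bl l])
      show "(\<lambda>k. G ((b \<circ> s \<circ> r) k) ((u \<circ> s \<circ> r) k) - V.val ((b \<circ> s \<circ> r) k)) \<longlonglongrightarrow> 0"
        using LIMSEQ_subseq_LIMSEQ[OF LIMSEQ_subseq_LIMSEQ[OF gap s] r] by (simp add: o_def)
    qed (simp_all add: bQ uU)
    then have "(\<lambda>k. ((b \<circ> s \<circ> r) k, S ((u \<circ> s \<circ> r) k), (u \<circ> s \<circ> r) k)) \<longlonglongrightarrow> z"
      unfolding z_def by (intro tendsto_Pair bl blinfun.tendsto tendsto_const)
    then have lim: "((\<lambda>k. x (Suc k)) \<circ> s \<circ> r) \<longlonglongrightarrow> z"
      by (simp add: o_def x_eq)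
    have "(\<lambda>k. F (((\<lambda>k. x (Suc k)) \<circ> s \<circ> r) k)) \<longlonglongrightarrow> F z"
      by (rule continuous_on_tendsto_compose[OF F_cont lim]) (simp_all add: z_def l x_eq bQ)
    then have "F z \<le> F z'" if "feas z'" for z'
      by (rule LIMSEQ_le_const2) (use F_le[OF reached that] in simp)
    then have "glob z"
      using feas_sol[OF l] unfolding glob_iff z_def by blast
    with r lim show ?thesis by blast
  qed

  have "(\<exists>k. reached f Uad A B x k \<and> stop_test f Uad A B (x k) \<and> glob (x k))
      \<or> ((\<forall>k\<ge>1. \<not> stop_test f Uad A B (x k)) \<and>
         (\<exists>r z. strict_mono (r :: nat \<Rightarrow> nat) \<and> (\<forall>j. 1 \<le> r j) \<and> glob z \<and> (\<lambda>j. x (r j)) \<longlonglongrightarrow> z))"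
  proof (cases "\<forall>k\<ge>1. \<not> stop_test f Uad A B (x k)")
    case True
    obtain r z where r: "strict_mono (r :: nat \<Rightarrow> nat)" and z: "glob z"
      and lim: "((\<lambda>k. x (Suc k)) \<circ> id \<circ> r) \<longlonglongrightarrow> z"
      using cluster[OF True strict_mono_id] by blast
    have "strict_mono (\<lambda>j. Suc (r j))" using r by (simp add: strict_mono_def)
    moreover have "(\<lambda>j. x (Suc (r j))) \<longlonglongrightarrow> z" using lim by (simp add: o_def)
    ultimately show ?thesis
      using True z by (intro disjI2 conjI exI[of _ "\<lambda>j. Suc (r j)"] exI[of _ z]) auto
  next
    case False
    define k where "k = (LEAST k. 1 \<le> k \<and> stop_test f Uad A B (x k))"
    have k: "1 \<le> k" "stop_test f Uad A B (x k)"
      using LeastI_ex[of "\<lambda>k. 1 \<le> k \<and> stop_test f Uad A B (x k)"] False unfolding k_def by blast+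
    have "reached f Uad A B x k"
      unfolding reached_def using k(1) not_less_Least[of _ "\<lambda>k. 1 \<le> k \<and> stop_test f Uad A B (x k)"]
      unfolding k_def by blast
    with k(2) stop_case show ?thesis by blast
  qed
  moreover have "x \<longlonglongrightarrow> z"
    if z: "glob z" "\<forall>z'. glob z' \<longrightarrow> z' = z" and nonstop: "\<forall>k\<ge>1. \<not> stop_test f Uad A B (x k)" for z
  proof -
    have "(\<lambda>k. x (Suc k)) \<longlonglongrightarrow> z"
      by (rule tendsto_if_subsequences_cluster) (use cluster[OF nonstop] z in blast)
    then show ?thesis by (rule LIMSEQ_imp_Suc)
  qed
  ultimately show ?thesis
    unfolding glob_def by blast
qed

end
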